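(* Let $N\ge 2$, $M\ge 2$ be integers, let $0<r\le 1/N$, let $\{f_1,\dots,f_N\}$ be an IFS on $[0,1]$ as in the context, let $\mathbf{p}=(p_1,\dots,p_N)\in[0,1]^N$ be a probability vector, and let $F=F(\omega)$ be the random set defined in the context. (a) (Lower bound) For $\mu_{\mathbf p}$-almost every $\omega$, $$\dim_H F(\omega)\ \ge\ \min\left\{-\frac{\log M}{\log r},\ \frac{\log(p_1^2+\dots+p_N^2)}{\log r}\right\}.$$ (b) (Upper bound) If $$\prod_{i=1}^N p_i^{-p_i}\ \le\ M\ \le\ \left(\prod_{i=1}^N p_i\right)^{-1/N},$$ then there is a unique $\lambda\in[0,1]$ satisfying $$\sum_{i=1}^N p_i^{\lambda}\log(Mp_i)=0,$$ and $$\overline{\dim}_B F(\omega)\ \le\ -\frac{\lambda\log M+\log\left(\sum_{i=1}^N p_i^{\lambda}\right)}{\log r}\qquad\text{for }\mu_{\mathbf p}\text{-almost every }\omega.$$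
   Context: IFS: $f_i:[0,1]\to[0,1]$, $f_i(x)=rx+b_i$ for $i=1,\dots,N$, with constants $b_i$ such that the open intervals $f_i((0,1))$ are pairwise disjoint and $f_i([0,1])$ lies to the left of $f_j([0,1])$ when $i<j$. Probability space: $\Omega=\{1,\dots,N\}^{\mathbb N}$ ($\mathbb N=\{1,2,\dots\}$) with its Borel $\sigma$-algebra and the product measure $\mu_{\mathbf p}$ under which the coordinates $\omega_1,\omega_2,\dots$ are i.i.d. with $\mu_{\mathbf p}(\omega_k=i)=p_i$. Tree: let $\mathcal I_n=\{1,\dots,M\}^n$, $\mathcal I_0=\{\epsilon\}$ with $\epsilon$ the empty word, $\mathcal I^*=\bigcup_{n\ge0}\mathcal I_n$, and $\mathcal I=\{1,\dots,M\}^{\mathbb N}$. Order $\mathcal I^*$ by: $\mathbf i<_*\mathbf j$ if $\mathbf i$ is shorter than $\mathbf j$, or if they have equal length and $\mathbf i$ precedes $\mathbf j$ lexicographically. Put $\kappa(\mathbf i)=\#\{\mathbf j\in\mathcal I^*:\mathbf j<_*\mathbf i\}$, so that $\kappa$ maps the nonempty words bijectively onto $\mathbb N$. For nonempty $\mathbf i\in\mathcal I^*$ let $X_{\mathbf i}(\omega)=\omega_{\kappa(\mathbf i)}$ (the random label of the edge of the $M$-ary tree leading to the node $\mathbf i$). Random set: writing $\mathbf i|_k=(i_1,\dots,i_k)$, $$F(\omega)=\Big\{x:\ \{x\}=\bigcap_{n\ge1} f_{X_{\mathbf i|_1}(\omega)}\circ f_{X_{\mathbf i|_2}(\omega)}\circ\dots\circ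 f_{X_{\mathbf i|_n}(\omega)}([0,1])\ \text{ for some }\mathbf i\in\mathcal I\Big\}.$$ $\dim_H$ is Hausdorff dimension and $\overline{\dim}_B$ is upper box-counting dimension.
   Formalization: Uniqueness of λ is claimed only for non-uniform p: if all p_i = 1/N then M = N and every λ in [0,1] is a root, so uniqueness fails; existence and the bound (for every root) are kept. In (b) all p_i must be positive, since otherwise (∏p_i)^(-1/N) and log(Mp_i) are undefined. *)

theory Defs
  imports "HOL-Probability.Probability"
begin

section \<open>Hausdorff and upper box-counting dimension\<close>

text \<open>The junk value of \<open>diameter\<close> on unbounded sets is excluded by requiring boundedness.
  Since \<open>0 powr 0 = 0\<close>, the sums below are the usual ones only for positive \<open>s\<close>;
  \<open>hausdorff_dim\<close> uses no other exponents, which does not change the infimum.\<close>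

definition hausdorff_premeasure :: "real \<Rightarrow> real \<Rightarrow> 'a::metric_space set \<Rightarrow> ennreal" where
  "hausdorff_premeasure s \<delta> E =
     Inf {(\<Sum>n. ennreal (diameter (U n) powr s)) | U :: nat \<Rightarrow> 'a set.
            E \<subseteq> (\<Union>n. U n) \<and> (\<forall>n. bounded (U n) \<and> diameter (U n) \<le> \<delta>)}"

definition hausdorff_measure :: "real \<Rightarrow> 'a::metric_space set \<Rightarrow> ennreal" where
  "hausdorff_measure s E = (SUP \<delta>\<in>{0<..}. hausdorff_premeasure s \<delta> E)"

definition hausdorff_dim :: "'a::metric_space set \<Rightarrow> ereal" where
  "hausdorff_dim E = Inf {ereal s | s. 0 < s \<and> hausdorff_measure s E = 0}"

text \<open>The covering number is meaningful only for totally bounded \<open>E\<close> (the infimum of the empty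
  set of naturals is \<open>0\<close>); the random sets below are subsets of the unit interval.\<close>

definition covering_number :: "real \<Rightarrow> 'a::metric_space set \<Rightarrow> nat" where
  "covering_number \<delta> E =
     Inf {card \<U> | \<U>. finite \<U> \<and> E \<subseteq> \<Union>\<U> \<and> (\<forall>U\<in>\<U>. bounded U \<and> diameter U \<le> \<delta>)}"

definition upper_box_dim :: "'a::metric_space set \<Rightarrow> ereal" where
  "upper_box_dim E =
     Limsup (at_right 0) (\<lambda>\<delta>. ereal (ln (real (covering_number \<delta> E)) / - ln \<delta>))"


section \<open>The iterated function system and the probability space\<close>

definition ifs_map :: "real \<Rightarrow> (nat \<Rightarrow> real) \<Rightarrow> nat \<Rightarrow> real \<Rightarrow> real" where
  "ifs_map r b i x = r * x + b i"

text \<open>Neighbouring images may share an endpoint, so ``to the left of'' is the weak inequality.\<close>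

definition unit_interval_ifs :: "nat \<Rightarrow> real \<Rightarrow> (nat \<Rightarrow> real) \<Rightarrow> bool" where
  "unit_interval_ifs N r b \<longleftrightarrow>
     (\<forall>i\<in>{1..N}. ifs_map r b i ` {0..1} \<subseteq> {0..1}) \<and>
     disjoint_family_on (\<lambda>i. ifs_map r b i ` {0<..<1}) {1..N} \<and>
     (\<forall>i\<in>{1..N}. \<forall>j\<in>{1..N}. i < j \<longrightarrow>
        (\<forall>x\<in>ifs_map r b i ` {0..1}. \<forall>y\<in>ifs_map r b j ` {0..1}. x \<le> y))"

definition prob_vector :: "nat \<Rightarrow> (nat \<Rightarrow> real) \<Rightarrow> bool" where
  "prob_vector N p \<longleftrightarrow> (\<forall>i\<in>{1..N}. 0 \<le> p i \<and> p i \<le> 1) \<and> (\<Sum>i=1..N. p i) = 1"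

definition label_space :: "nat \<Rightarrow> (nat \<Rightarrow> real) \<Rightarrow> (nat \<Rightarrow> nat) measure" where
  "label_space N p = Pi\<^sub>M {1..} (\<lambda>_. point_measure {1..N} (\<lambda>i. ennreal (p i)))"


section \<open>The labelled tree and the random set\<close>

text \<open>Finite words are lists over \<open>{1..M}\<close>; \<open>lenlex\<close> compares lengths first and then, for equal
  lengths, lexicographically.\<close>

definition kappa :: "nat \<Rightarrow> nat list \<Rightarrow> nat" where
  "kappa M w = card {v \<in> lists {1..M}. (v, w) \<in> lenlex less_than}"

definition edge_label :: "nat \<Rightarrow> (nat \<Rightarrow> nat) \<Rightarrow> nat list \<Rightarrow> nat" where
  "edge_label M \<omega> w = \<omega> (kappa M w)"

definition word_prefix :: "(nat \<Rightarrow> nat) \<Rightarrow> nat \<Rightarrow> nat list" where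
  "word_prefix \<iota> k = map \<iota> [1..<Suc k]"

definition branch_map ::
  "nat \<Rightarrow> real \<Rightarrow> (nat \<Rightarrow> real) \<Rightarrow> (nat \<Rightarrow> nat) \<Rightarrow> (nat \<Rightarrow> nat) \<Rightarrow> nat \<Rightarrow> real \<Rightarrow> real" where
  "branch_map M r b \<omega> \<iota> n =
     foldr (\<circ>) (map (\<lambda>k. ifs_map r b (edge_label M \<omega> (word_prefix \<iota> k))) [1..<Suc n]) id"

text \<open>Infinite words are indexed from 1; the value of \<open>\<iota>\<close> at 0 is never used.\<close>

definition random_fractal ::
  "nat \<Rightarrow> real \<Rightarrow> (nat \<Rightarrow> real) \<Rightarrow> (nat \<Rightarrow> nat) \<Rightarrow> real set" where
  "random_fractal M r b \<omega> =
     {x. \<exists>\<iota>. (\<forall>k\<ge>1. \<iota> k \<in> {1..M}) \<and> {x} = (\<Inter>n\<in>{1..}. branch_map M r b \<omega> \<iota> n ` {0..1})}"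


text \<open>In the hypothesis of the upper bound, \<open>(\<Prod>i. p i) powr (- 1 / N)\<close> is undefined on paper
  when some \<open>p i\<close> vanishes; in HOL it is then \<open>0\<close>, so the hypothesis entails that all
  \<open>p i\<close> are nonzero, and the values of \<open>ln\<close> and \<open>powr\<close> at 0 play no role.
  For \<open>p i = 1 / N\<close> that hypothesis forces \<open>M = N\<close>, and then every \<open>l\<close> in the unit interval solves
  \<open>(\<Sum>i. p i powr l * ln (M * p i)) = 0\<close>; hence uniqueness of the solution is claimed only for
  non-uniform \<open>p\<close>.\<close>

lemma prob_nonzero_if_le_geometric_mean:
  fixes p :: "nat \<Rightarrow> real"
  assumes "0 < M" and "real M \<le> (\<Prod>i=1..N. p i) powr (- 1 / real N)"
  shows "\<forall>i\<in>{1..N}. p i \<noteq> 0"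
proof
  fix i assume "i \<in> {1..N}"
  show "p i \<noteq> 0"
  proof
    assume "p i = 0"
    with \<open>i \<in> {1..N}\<close> have "(\<Prod>i=1..N. p i) = 0" by (intro prod_zero) auto
    then have "(\<Prod>i=1..N. p i) powr (- 1 / real N) = 0" by (simp only: powr_0)
    with assms show False by linarith
  qed
qed

end

theory Submission
  imports Defs
begin

text \<open>A node \<open>u\<close> of the \<open>M\<close>-ary tree at level \<open>n\<close> carries the word of labels read along the path
  leading to it, and this word addresses a cell of length \<open>r ^ n\<close> in the unit interval. The random
  set consists of the points that lie in all cells along one infinite branch. Both bounds
  are first-moment estimates, summed over all levels \<open>n\<close>: a series of nonnegative random variables
  whose expectations have a finite sum converges almost surely
  (\<open>AE_suminf_finite\<close>).

  Upper bound. A label word \<open>x\<close> of length \<open>n\<close> occurs at one of the \<open>M ^ n\<close> nodes of level \<open>n\<close> with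
  probability at most \<open>min 1 (\<Prod>i\<leftarrow>x. M * p i)\<close>. The inequality \<open>min 1 t \<le> t powr l\<close>, for
  \<open>l\<close> between 0 and 1, replaces the minimum by something multiplicative, and summation over \<open>x\<close> bounds the
  expected number of occurring words by the \<open>n\<close>-th power of
  \<open>(\<Sum>i=1..N. (M * p i) powr l) = M powr l * (\<Sum>i=1..N. p i powr l)\<close>. The cells of the occurring words
  cover the random set, so the logarithm of this growth rate, divided by \<open>- ln r\<close>, bounds the upper
  box dimension (\<open>AE_upper_box_dim_random_fractal_le\<close>). The rate is a convex function of \<open>l\<close>, and the
  equation \<open>(\<Sum>i=1..N. p i powr l * ln (M * p i)) = 0\<close> says that its derivative
  vanishes: it selects the best \<open>l\<close>. The two inequalities for \<open>M\<close> are the sign conditions at the endpoints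
  that put the minimum into the unit interval, and strict convexity for non-uniform \<open>p\<close> makes it unique.

  Lower bound. This is the energy method, with the energy in discretised form. Choosing a branch of the
  tree uniformly at random induces a random measure on the random set. Its \<open>t\<close>-energy is
  comparable to \<open>(\<Sum>m. r powr (- t * m) * P m)\<close>, where \<open>P m\<close> is the probability that
  two independent branches have cells of level \<open>m\<close> within distance \<open>2 * r ^ m\<close>. Two branches agree on exactly
  their first \<open>n\<close> letters with probability at most \<open>M powr (- n)\<close>; afterwards their labels are
  independent, so that the cells are close with probability at most a constant times \<open>q ^ (m - n)\<close>, with
  \<open>q = (\<Sum>i=1..N. (p i)\<^sup>2)\<close> (\<open>emeasure_close_pair_le\<close>). The expected
  energy is therefore at most a Cauchy product of two geometric series, with ratios
  \<open>r powr (- t) / M\<close> and \<open>r powr (- t) * q\<close>. Both converge precisely if \<open>t\<close> is below the two terms of the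
  minimum. Finite energy forces the \<open>t\<close>-dimensional Hausdorff measure to be positive
  (\<open>hausdorff_measure_nonzero_if_finite_energy\<close>).\<close>

section \<open>Words\<close>

definition words :: "nat \<Rightarrow> nat \<Rightarrow> nat list set" where
  "words M n = {w \<in> lists {1..M}. length w = n}"

lemma words_eq: "words M n = {w. set w \<subseteq> {1..M} \<and> length w = n}"
  by (auto simp: words_def)

lemma finite_words [simp]: "finite (words M n)"
  unfolding words_eq by (rule finite_lists_length_eq) simp

lemma card_words [simp]: "card (words M n) = M ^ n"
  unfolding words_eq by (subst card_lists_length_eq) simp_all

lemma words_0 [simp]: "words M 0 = {[]}"
  by (auto simp: words_def)

lemma append_in_words: "u \<in> words M m \<Longrightarrow> v \<in> words M n \<Longrightarrow> u @ v \<in> words M (m + n)"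
  by (auto simp: words_def)

lemma take_in_words: "u \<in> words M m \<Longrightarrow> k \<le> m \<Longrightarrow> take k u \<in> words M k"
  by (auto simp: words_eq dest: in_set_takeD)

lemma drop_in_words: "u \<in> words M m \<Longrightarrow> drop k u \<in> words M (m - k)"
  by (auto simp: words_eq dest: in_set_dropD)

lemma card_common_prefix_le: "card {v \<in> words M m. take n u = take n v} \<le> M ^ (m - n)"
proof -
  have "inj_on (drop n) {v \<in> words M m. take n u = take n v}"
    by (rule inj_onI) (metis (mono_tags, lifting) append_take_drop_id mem_Collect_eq)
  then have "card {v \<in> words M m. take n u = take n v} \<le> card (words M (m - n))"
    by (rule card_inj_on_le) (auto intro: drop_in_words)
  then show ?thesis by simp
qed

text \<open>Weights of words are multiplicative in the letters; this expansion is what turns every sum over the label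
  words of length \<open>n\<close> into an \<open>n\<close>-th power.\<close>

lemma sum_prod_list_words:
  fixes g :: "nat \<Rightarrow> 'a::comm_semiring_1"
  shows "(\<Sum>x\<in>words N n. prod_list (map g x)) = (\<Sum>i=1..N. g i) ^ n"
proof (induction n)
  case (Suc n)
  have eq: "words N (Suc n) = (\<lambda>(i, x). i # x) ` ({1..N} \<times> words N n)"
    by (auto simp: words_def length_Suc_conv image_iff)
  have "(\<Sum>x\<in>words N (Suc n). prod_list (map g x))
      = (\<Sum>(i, x)\<in>{1..N} \<times> words N n. g i * prod_list (map g x))"
    unfolding eq by (subst sum.reindex) (auto simp: inj_on_def case_prod_unfold)
  also have "\<dots> = (\<Sum>i=1..N. g i) * (\<Sum>x\<in>words N n. prod_list (map g x))"
    by (simp add: sum.cartesian_product[symmetric] sum_product)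
  finally show ?case by (simp add: Suc)
qed simp

lemma prod_list_powr:
  fixes f :: "'b \<Rightarrow> real"
  assumes "\<And>i. i \<in> set x \<Longrightarrow> 0 \<le> f i"
  shows "(\<Prod>i\<leftarrow>x. f i) powr l = (\<Prod>i\<leftarrow>x. f i powr l)" and "0 \<le> (\<Prod>i\<leftarrow>x. f i)"
proof -
  have "0 \<le> (\<Prod>i\<leftarrow>x. f i) \<and> (\<Prod>i\<leftarrow>x. f i) powr l = (\<Prod>i\<leftarrow>x. f i powr l)"
    using assms by (induction x) (auto simp: powr_mult)
  then show "(\<Prod>i\<leftarrow>x. f i) powr l = (\<Prod>i\<leftarrow>x. f i powr l)" "0 \<le> (\<Prod>i\<leftarrow>x. f i)" by auto
qed

lemma prod_list_pos_real: "(\<And>i. i \<in> set x \<Longrightarrow> 0 < f i) \<Longrightarrow> 0 < (\<Prod>i\<leftarrow>x. f i :: real)"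
  by (induction x) auto

section \<open>Independent labels\<close>

lemma finite_kappa_set: "finite {v \<in> lists {1..M}. (v, w) \<in> lenlex less_than}"
proof (rule finite_subset)
  show "{v \<in> lists {1..M}. (v, w) \<in> lenlex less_than}
      \<subseteq> {v. set v \<subseteq> {1..M} \<and> length v \<le> length w}"
    by (auto simp: lenlex_conv)
qed (simp add: finite_lists_length_le)

lemma kappa_less:
  assumes "v \<in> lists {1..M}" "(v, w) \<in> lenlex less_than"
  shows "kappa M v < kappa M w"
  unfolding kappa_def
proof (rule psubset_card_mono[OF finite_kappa_set])
  have "trans (lenlex less_than)" by (simp add: lenlex_transI)
  moreover have "(v, v) \<notin> lenlex less_than" by (simp add: lenlex_irreflexive)
  ultimately show "{u \<in> lists {1..M}. (u, v) \<in> lenlex less_than}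
      \<subset> {u \<in> lists {1..M}. (u, w) \<in> lenlex less_than}"
    using assms by (auto dest: transD)
qed

text \<open>The order by length and then lexicographically is total, and \<open>kappa\<close> is strictly
  increasing for it. So distinct nodes read distinct coordinates of \<open>\<omega>\<close>, which is why labels of
  distinct edges are independent.\<close>

lemma inj_on_kappa: "inj_on (kappa M) (lists {1..M})"
proof (rule inj_onI, rule ccontr)
  fix v w assume vw: "v \<in> lists {1..M}" "w \<in> lists {1..M}" "kappa M v = kappa M w" "v \<noteq> w"
  have "total (lenlex less_than)" by (simp add: total_lenlex)
  then have "(v, w) \<in> lenlex less_than \<or> (w, v) \<in> lenlex less_than"
    using vw by (auto simp: total_on_def)
  with vw kappa_less[of v M w] kappa_less[of w M v] show False by auto
qed

lemma kappa_pos: "w \<noteq> [] \<Longrightarrow> kappa M w \<in> {1..}"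
  using kappa_less[of "[]" M w] by (auto simp: lenlex_conv)

lemma prob_space_point_measure:
  assumes "prob_vector N p"
  shows "prob_space (point_measure {1..N} (\<lambda>i. ennreal (p i)))"
proof (rule prob_spaceI)
  have "(\<Sum>i=1..N. ennreal (p i)) = ennreal (\<Sum>i=1..N. p i)"
    using assms by (intro sum_ennreal) (auto simp: prob_vector_def)
  with assms show "emeasure (point_measure {1..N} (\<lambda>i. ennreal (p i)))
      (space (point_measure {1..N} (\<lambda>i. ennreal (p i)))) = 1"
    by (simp add: space_point_measure emeasure_point_measure_finite prob_vector_def)
qed

lemma prob_space_label_space: "prob_vector N p \<Longrightarrow> prob_space (label_space N p)"
  unfolding label_space_def by (intro prob_space_PiM prob_space_point_measure)

lemma label_in_range: "\<omega> \<in> space (label_space N p) \<Longrightarrow> 1 \<le> k \<Longrightarrow> \<omega> k \<in> {1..N}"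
  using PiE_mem[of \<omega> "{1..}" "\<lambda>_. {1..N}" k] by (simp add: label_space_def space_PiM space_point_measure)

lemma measurable_label [measurable]:
  "1 \<le> k \<Longrightarrow> (\<lambda>\<omega>. \<omega> k) \<in> label_space N p \<rightarrow>\<^sub>M count_space UNIV"
proof -
  assume "1 \<le> k"
  then have "(\<lambda>\<omega>. \<omega> k) \<in> label_space N p \<rightarrow>\<^sub>M point_measure {1..N} (\<lambda>i. ennreal (p i))"
    unfolding label_space_def by (intro measurable_component_singleton) simp
  then have "(\<lambda>\<omega>. \<omega> k) \<in> label_space N p \<rightarrow>\<^sub>M count_space {1..N}"
    by (subst measurable_cong_sets[OF refl, of _ "point_measure {1..N} (\<lambda>i. ennreal (p i))"])
       (auto simp: sets_point_measure)
  moreover have "(\<lambda>x. x) \<in> count_space {1..N} \<rightarrow>\<^sub>M count_space UNIV" by simp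
  ultimately show ?thesis by (rule measurable_compose)
qed

lemma measurable_label_list [measurable]:
  assumes "set ks \<subseteq> {1..}"
  shows "(\<lambda>\<omega>. map \<omega> ks) \<in> label_space N p \<rightarrow>\<^sub>M count_space UNIV"
proof (subst measurable_count_space_eq2_countable)
  have "(\<lambda>\<omega>. map \<omega> ks) -` {z} \<inter> space (label_space N p) \<in> sets (label_space N p)" for z
  proof -
    have "(\<lambda>\<omega>. map \<omega> ks) -` {z} \<inter> space (label_space N p)
        = {\<omega>\<in>space (label_space N p). length ks = length z \<and> (\<forall>i\<in>{..<length ks}. \<omega> (ks ! i) = z ! i)}"
      by (auto simp: list_eq_iff_nth_eq)
    also have "\<dots> \<in> sets (label_space N p)"
    proof -
      have "Measurable.pred (label_space N p) (\<lambda>\<omega>. \<omega> (ks ! i) = z ! i)" if "i \<in> {..<length ks}" for i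
      proof -
        have "1 \<le> ks ! i" using assms that nth_mem by fastforce
        from measurable_label[OF this, of N p] show ?thesis by measurable
      qed
      then show ?thesis by measurable
    qed
    finally show ?thesis .
  qed
  then show "(\<lambda>\<omega>. map \<omega> ks) \<in> space (label_space N p) \<rightarrow> UNIV \<and>
     (\<forall>z\<in>UNIV. (\<lambda>\<omega>. map \<omega> ks) -` {z} \<inter> space (label_space N p) \<in> sets (label_space N p))"
    by auto
qed

text \<open>Independence of the coordinates. The hypothesis \<open>distinct ks\<close> is essential, and is the
  reason for proving below that paths of the tree never read the same coordinate twice.\<close>

lemma emeasure_label_list:
  assumes "prob_vector N p" and ks: "distinct ks" "set ks \<subseteq> {1..}" and z: "z \<in> words N (length ks)"
  shows "emeasure (label_space N p) {\<omega> \<in> space (label_space N p). map \<omega> ks = z}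
       = ennreal (prod_list (map p z))"
proof -
  let ?P = "point_measure {1..N} (\<lambda>i. ennreal (p i))"
  interpret product_prob_space "\<lambda>_. ?P" "{1..}"
    by (intro product_prob_spaceI prob_space_point_measure assms)
  \<comment> \<open>The event is the cylinder over the index set \<open>set ks\<close> whose side at the index \<open>ks ! i\<close> is \<open>{z ! i}\<close>.\<close>
  define f where "f = (\<lambda>k. {z ! (THE i. i < length ks \<and> ks ! i = k)})"
  have f: "f (ks ! i) = {z ! i}" if "i < length ks" for i
  proof -
    have "(THE j. j < length ks \<and> ks ! j = ks ! i) = i"
      using that ks(1) by (intro the_equality) (auto simp: nth_eq_iff_index_eq)
    then show ?thesis by (simp add: f_def)
  qed
  have zi: "z ! i \<in> {1..N}" if "i < length ks" for i
    using z that by (auto simp: words_eq subset_iff)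
  have fs: "f k \<in> sets ?P" if "k \<in> set ks" for k
    using that f zi by (auto simp: in_set_conv_nth sets_point_measure)
  have "{\<omega> \<in> space (label_space N p). map \<omega> ks = z}
      = emb {1..} (set ks) (Pi\<^sub>E (set ks) f)"
  proof -
    have "map \<omega> ks = z \<longleftrightarrow> (\<forall>k\<in>set ks. \<omega> k \<in> f k)" for \<omega>
      using z f by (auto simp: words_def list_eq_iff_nth_eq all_set_conv_all_nth)
    then show ?thesis
      by (auto simp: prod_emb_def label_space_def restrict_PiE_iff space_PiM)
  qed
  also have "emeasure (label_space N p) \<dots> = (\<Prod>k\<in>set ks. emeasure ?P (f k))"
    unfolding label_space_def using ks fs by (intro emeasure_PiM_emb) auto
  also have "\<dots> = prod_list (map (\<lambda>k. emeasure ?P (f k)) ks)"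
    using ks(1) by (simp add: prod.distinct_set_conv_list)
  also have "map (\<lambda>k. emeasure ?P (f k)) ks = map (\<lambda>i. ennreal (p i)) z"
    using z f zi by (intro nth_equalityI) (auto simp: words_def emeasure_point_measure_finite)
  also have "prod_list \<dots> = ennreal (prod_list (map p z))"
  proof -
    have "set z \<subseteq> {1..N}" using z by (simp add: words_eq)
    then show ?thesis
      using assms(1) 
      by (induction z) (auto simp: prob_vector_def ennreal_mult' )
  qed
  finally show ?thesis .
qed

section \<open>Labels along paths of the tree\<close>

definition path_indices :: "nat \<Rightarrow> nat list \<Rightarrow> nat list" where
  "path_indices M u = map (\<lambda>k. kappa M (take k u)) [1..<Suc (length u)]"

definition path_labels :: "nat \<Rightarrow> (nat \<Rightarrow> nat) \<Rightarrow> nat list \<Rightarrow> nat list" where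
  "path_labels M \<omega> u = map \<omega> (path_indices M u)"

lemma length_path_indices [simp]: "length (path_indices M u) = length u"
  by (simp add: path_indices_def del: upt_Suc)

lemma length_path_labels [simp]: "length (path_labels M \<omega> u) = length u"
  by (simp add: path_labels_def)

lemma path_indices_nth: "k < length u \<Longrightarrow> path_indices M u ! k = kappa M (take (Suc k) u)"
  by (simp add: path_indices_def nth_append del: upt_Suc)

lemma set_path_indices: "set (path_indices M u) \<subseteq> {1..}"
proof
  fix j assume "j \<in> set (path_indices M u)"
  then obtain k where "k < length u" "j = kappa M (take (Suc k) u)"
    by (auto simp: in_set_conv_nth path_indices_nth)
  then show "j \<in> {1..}" using kappa_pos[of "take (Suc k) u" M] by force
qed

lemma kappa_take_eq_iff:
  assumes "u \<in> words M m" "v \<in> words M m" "k \<le> m" "l \<le> m"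
  shows "kappa M (take k u) = kappa M (take l v) \<longleftrightarrow> k = l \<and> take k u = take k v"
proof -
  have "take k u \<in> lists {1..M}" "take l v \<in> lists {1..M}"
    using take_in_words assms by (auto simp: words_def)
  then have "kappa M (take k u) = kappa M (take l v) \<longleftrightarrow> take k u = take l v"
    by (rule inj_on_eq_iff[OF inj_on_kappa])
  also have "\<dots> \<longleftrightarrow> k = l \<and> take k u = take k v"
  proof -
    have "length (take k u) = k" "length (take l v) = l" using assms by (auto simp: words_def)
    then show ?thesis by metis
  qed
  finally show ?thesis .
qed

lemma distinct_path_indices:
  assumes "u \<in> words M m" shows "distinct (path_indices M u)"
  using assms kappa_take_eq_iff[OF assms assms]
  by (auto simp: distinct_conv_nth path_indices_nth words_def)

text \<open>After the paths to \<open>u\<close> and \<open>v\<close> have separated they never share an edge again, since a common edge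
  would force a common prefix. By \<open>emeasure_label_list\<close> the two remaining label words are then
  independent. At \<open>n = m\<close> both remainders are empty.\<close>

lemma distinct_path_indices_append:
  assumes u: "u \<in> words M m" and v: "v \<in> words M m"
    and differ: "n < m \<Longrightarrow> u ! n \<noteq> v ! n"
  shows "distinct (drop n (path_indices M u) @ drop n (path_indices M v))"
proof -
  have len: "length u = m" "length v = m" using u v by (auto simp: words_def)
  have "path_indices M u ! (n + i) \<noteq> path_indices M v ! (n + j)" if "n + i < m" "n + j < m" for i j
  proof
    assume "path_indices M u ! (n + i) = path_indices M v ! (n + j)"
    then have "kappa M (take (Suc (n + i)) u) = kappa M (take (Suc (n + j)) v)"
      using that len by (simp add: path_indices_nth)
    then have "take (Suc (n + i)) u = take (Suc (n + i)) v"
      by (subst (asm) kappa_take_eq_iff[OF u v]) (use that in auto)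
    then have "take (Suc (n + i)) u ! n = take (Suc (n + i)) v ! n" by simp
    then have "u ! n = v ! n" by (subst (asm) (1 2) nth_take) auto
    with differ that show False by auto
  qed
  then have "set (drop n (path_indices M u)) \<inter> set (drop n (path_indices M v)) = {}"
  proof -
    have "drop n (path_indices M u) ! i \<noteq> drop n (path_indices M v) ! j"
      if "i < length (drop n (path_indices M u))" "j < length (drop n (path_indices M v))" for i j
      using that len \<open>\<And>j i. n + i < m \<Longrightarrow> n + j < m \<Longrightarrow> path_indices M u ! (n + i) \<noteq> path_indices M v ! (n + j)\<close>
      by simp
    then show ?thesis
      by (metis disjoint_iff in_set_conv_nth)
  qed
  then show ?thesis
    using distinct_path_indices[OF u] distinct_path_indices[OF v] by simp
qed

lemma path_labels_in_words:
  assumes "\<omega> \<in> space (label_space N p)" "u \<in> words M m"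
  shows "path_labels M \<omega> u \<in> words N m"
  using assms(2) set_path_indices[of M u] label_in_range[OF assms(1)]
  unfolding path_labels_def words_eq by auto

lemma take_path_labels:
  assumes "take n u = take n v" "n \<le> length u" "n \<le> length v"
  shows "take n (path_labels M \<omega> u) = take n (path_labels M \<omega> v)"
proof (rule nth_equalityI)
  fix i assume "i < length (take n (path_labels M \<omega> u))"
  then have i: "i < n" "i < length u" "i < length v" using assms by auto
  have "take (Suc i) (take n u) = take (Suc i) (take n v)" using assms(1) by simp
  then have "take (Suc i) u = take (Suc i) v" using i by (simp add: min_def)
  with i show "take n (path_labels M \<omega> u) ! i = take n (path_labels M \<omega> v) ! i"
    by (simp add: path_labels_def path_indices_nth)
qed (use assms in simp)

lemma measurable_path_labels [measurable]:
  "(\<lambda>\<omega>. path_labels M \<omega> u) \<in> label_space N p \<rightarrow>\<^sub>M count_space UNIV"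
  unfolding path_labels_def by (rule measurable_label_list[OF set_path_indices])

section \<open>Cells of the iterated function system\<close>

text \<open>Left endpoint of the cell addressed by the label word \<open>x\<close>; the cell has length
  \<open>r ^ length x\<close>.\<close>

definition cell_left :: "real \<Rightarrow> (nat \<Rightarrow> real) \<Rightarrow> nat list \<Rightarrow> real" where
  "cell_left r b x = foldr (ifs_map r b) x 0"

lemma cell_left_Nil [simp]: "cell_left r b [] = 0"
  by (simp add: cell_left_def)

lemma cell_left_Cons [simp]: "cell_left r b (i # x) = b i + r * cell_left r b x"
  by (simp add: cell_left_def ifs_map_def)

lemma foldr_ifs_map: "foldr (ifs_map r b) x y = cell_left r b x + r ^ length x * y"
  by (induction x) (auto simp: ifs_map_def algebra_simps)

lemma cell_left_append: "cell_left r b (x @ y) = cell_left r b x + r ^ length x * cell_left r b y"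
  by (induction x) (auto simp: algebra_simps)

lemma ifs_offset_bounds:
  assumes "unit_interval_ifs N r b" "i \<in> {1..N}"
  shows "0 \<le> b i" "b i \<le> 1 - r"
proof -
  have "ifs_map r b i ` {0..1} \<subseteq> {0..1}" using assms by (auto simp: unit_interval_ifs_def)
  moreover have "ifs_map r b i 0 \<in> ifs_map r b i ` {0..1}" "ifs_map r b i 1 \<in> ifs_map r b i ` {0..1}"
    by auto
  ultimately have "ifs_map r b i 0 \<in> {0..1}" "ifs_map r b i 1 \<in> {0..1}" by blast+
  then show "0 \<le> b i" "b i \<le> 1 - r" by (auto simp: ifs_map_def)
qed

lemma ifs_offset_gap:
  assumes "unit_interval_ifs N r b" "i \<in> {1..N}" "j \<in> {1..N}" "i < j"
  shows "b i + r \<le> b j"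
proof -
  have "\<forall>x\<in>ifs_map r b i ` {0..1}. \<forall>y\<in>ifs_map r b j ` {0..1}. x \<le> y"
    using assms unfolding unit_interval_ifs_def by blast
  then have "ifs_map r b i 1 \<le> ifs_map r b j 0" by auto
  then show ?thesis by (simp add: ifs_map_def)
qed

lemma cell_left_bounds:
  assumes "unit_interval_ifs N r b" "0 < r" "x \<in> words N n"
  shows "0 \<le> cell_left r b x" "cell_left r b x \<le> 1 - r ^ n"
proof -
  have "0 \<le> cell_left r b x \<and> cell_left r b x \<le> 1 - r ^ length x" if "set x \<subseteq> {1..N}"
    using that
  proof (induction x)
    case (Cons i x)
    then have "r * cell_left r b x \<le> r * (1 - r ^ length x)" "0 \<le> r * cell_left r b x"
      using assms(2) by (auto intro!: mult_left_mono)
    moreover have "0 \<le> b i" "b i \<le> 1 - r"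
      using ifs_offset_bounds[OF assms(1), of i] Cons.prems by auto
    ultimately show ?case by (auto simp: algebra_simps)
  qed simp
  with assms(3) show "0 \<le> cell_left r b x" "cell_left r b x \<le> 1 - r ^ n"
    by (auto simp: words_eq)
qed

text \<open>Cells of the same level have disjoint interiors and a common length, so their left
  endpoints differ by at least that length. At the first differing letter \<open>i < j\<close>
  the two cells lie in the images of the maps \<open>i\<close> and \<open>j\<close>, which are ordered.\<close>

lemma cell_left_separated:
  assumes ifs: "unit_interval_ifs N r b" "0 < r"
    and "x \<in> words N n" "y \<in> words N n" "x \<noteq> y"
  shows "r ^ n \<le> \<bar>cell_left r b x - cell_left r b y\<bar>"
proof -
  have first_letter: "r * r ^ n \<le> cell_left r b (j # y) - cell_left r b (i # x)"
    if "x \<in> words N n" "y \<in> words N n" "i \<in> {1..N}" "j \<in> {1..N}" "i < j" for i j x y n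
  proof -
    have "b i + r \<le> b j" using ifs_offset_gap[OF ifs(1)] that by blast
    moreover have "r * cell_left r b x \<le> r * (1 - r ^ n)" "0 \<le> r * cell_left r b y"
      using cell_left_bounds[OF ifs] that ifs(2) by (auto intro!: mult_left_mono)
    ultimately show ?thesis by (simp add: algebra_simps)
  qed
  show ?thesis
    using assms(3-)
  proof (induction n arbitrary: x y)
    case (Suc n)
    obtain i x' where x: "x = i # x'" "i \<in> {1..N}" "x' \<in> words N n"
      using Suc.prems(1) by (auto simp: words_eq length_Suc_conv)
    obtain j y' where y: "y = j # y'" "j \<in> {1..N}" "y' \<in> words N n"
      using Suc.prems(2) by (auto simp: words_eq length_Suc_conv)
    consider "i = j" | "i < j" | "j < i" by linarith
    then show ?case
    proof cases
      case 1
      then have "r ^ n \<le> \<bar>cell_left r b x' - cell_left r b y'\<bar>" using Suc x y by auto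
      then have "r * r ^ n \<le> r * \<bar>cell_left r b x' - cell_left r b y'\<bar>"
        using ifs(2) by (intro mult_left_mono) auto
      also have "\<dots> = \<bar>r * (cell_left r b x' - cell_left r b y')\<bar>" using ifs(2) by (simp add: abs_mult)
      also have "\<dots> = \<bar>cell_left r b x - cell_left r b y\<bar>" using 1 x y by (simp add: algebra_simps)
      finally show ?thesis by simp
    next
      case 2
      then show ?thesis using first_letter[of x' n y' i j] x y by auto
    next
      case 3
      then show ?thesis using first_letter[of y' n x' j i] x y by auto
    qed
  qed simp
qed

text \<open>Measured in units of \<open>r ^ n\<close>, separated endpoints have different integer parts, and there are only five
  integers from \<open>-2\<close> to \<open>2\<close>. The radius \<open>2 * r ^ n\<close> is the one that arises for two points at distance at most
  \<open>r ^ n\<close> in cells of length \<open>r ^ n\<close>.\<close>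

lemma card_close_cells_le:
  assumes ifs: "unit_interval_ifs N r b" "0 < r"
  shows "card {y \<in> words N n. \<bar>c - cell_left r b y\<bar> \<le> 2 * r ^ n} \<le> 5"
proof -
  let ?Y = "{y \<in> words N n. \<bar>c - cell_left r b y\<bar> \<le> 2 * r ^ n}"
  let ?k = "\<lambda>y. \<lfloor>(cell_left r b y - c) / r ^ n\<rfloor>"
  have rn: "0 < r ^ n" using ifs by simp
  have "inj_on ?k ?Y"
  proof (rule inj_onI, rule ccontr)
    fix x y assume xy: "x \<in> ?Y" "y \<in> ?Y" "?k x = ?k y" "x \<noteq> y"
    have "\<bar>(cell_left r b x - c) / r ^ n - (cell_left r b y - c) / r ^ n\<bar> < 1"
      using xy(3) by linarith
    then have "\<bar>cell_left r b x - cell_left r b y\<bar> < r ^ n"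
      using rn by (simp add: diff_divide_distrib[symmetric])
    then show False using cell_left_separated[OF ifs, of x n y] xy by auto
  qed
  moreover have "?k ` ?Y \<subseteq> {-2..2}"
  proof
    fix z assume "z \<in> ?k ` ?Y"
    then obtain y where y: "y \<in> ?Y" "z = ?k y" by blast
    have "-2 \<le> (cell_left r b y - c) / r ^ n" "(cell_left r b y - c) / r ^ n \<le> 2"
      using y rn by (auto simp: pos_le_divide_eq pos_divide_le_eq abs_le_iff)
    with y show "z \<in> {-2..2}" by (auto simp: le_floor_iff floor_le_iff)
  qed
  ultimately have "card ?Y \<le> card {-2..2::int}" by (intro card_inj_on_le) auto
  then show ?thesis by simp
qed

section \<open>Branches and points of the random set\<close>

lemma word_prefix_in_words:
  "\<forall>k\<ge>1. \<iota> k \<in> {1..M} \<Longrightarrow> word_prefix \<iota> n \<in> words M n"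
  by (auto simp: word_prefix_def words_eq simp del: upt_Suc)

lemma take_word_prefix: "k \<le> n \<Longrightarrow> take k (word_prefix \<iota> n) = word_prefix \<iota> k"
  by (simp add: word_prefix_def take_map del: upt_Suc)

lemma length_word_prefix [simp]: "length (word_prefix \<iota> n) = n"
  by (simp add: word_prefix_def del: upt_Suc)

lemma path_labels_word_prefix:
  "path_labels M \<omega> (word_prefix \<iota> n) = map (\<lambda>k. edge_label M \<omega> (word_prefix \<iota> k)) [1..<Suc n]"
  unfolding path_labels_def path_indices_def edge_label_def map_map length_word_prefix o_def
  by (rule map_cong[OF refl], subst take_word_prefix) (simp_all del: upt_Suc)

lemma branch_map_image:
  assumes "0 < r"
  shows "branch_map M r b \<omega> \<iota> n ` {0..1} =
    (let c = cell_left r b (path_labels M \<omega> (word_prefix \<iota> n)) in {c..c + r ^ n})"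
proof -
  have "foldr (\<circ>) (map (\<lambda>k. ifs_map r b (edge_label M \<omega> (word_prefix \<iota> k))) ks) id y
      = foldr (ifs_map r b) (map (\<lambda>k. edge_label M \<omega> (word_prefix \<iota> k)) ks) y" for ks y
    by (induction ks) auto
  then have "branch_map M r b \<omega> \<iota> n
      = (\<lambda>y. r ^ n * y + cell_left r b (path_labels M \<omega> (word_prefix \<iota> n)))"
    unfolding branch_map_def path_labels_word_prefix
    by (auto simp: foldr_ifs_map simp del: upt_Suc)
  then show ?thesis
    using assms by (simp add: Let_def image_affinity_atLeastAtMost)
qed

lemma random_fractal_covered:
  assumes "0 < r" "x \<in> random_fractal M r b \<omega>" "1 \<le> n"
  shows "\<exists>u\<in>words M n. x \<in> {cell_left r b (path_labels M \<omega> u)..cell_left r b (path_labels M \<omega> u) + r ^ n}"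
proof -
  obtain \<iota> where \<iota>: "\<forall>k\<ge>1. \<iota> k \<in> {1..M}"
    "{x} = (\<Inter>n\<in>{1..}. branch_map M r b \<omega> \<iota> n ` {0..1})"
    using assms(2) by (auto simp: random_fractal_def)
  have "x \<in> (\<Inter>n\<in>{1..}. branch_map M r b \<omega> \<iota> n ` {0..1})" using \<iota>(2) by blast
  then have "x \<in> branch_map M r b \<omega> \<iota> n ` {0..1}" using assms(3) by blast
  then show ?thesis
    unfolding branch_map_image[OF assms(1)] Let_def
    by (intro bexI[OF _ word_prefix_in_words[OF \<iota>(1)]])
qed

text \<open>The cells along a branch form a nested sequence of compact intervals with lengths tending to 0, so
  every branch codes a point of the random set.\<close>

lemma random_fractal_point:
  assumes ifs: "unit_interval_ifs N r b" "0 < r" "r < 1"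
    and \<omega>: "\<omega> \<in> space (label_space N p)" and \<iota>: "\<forall>k\<ge>1. \<iota> k \<in> {1..M}"
  shows "\<exists>x\<in>random_fractal M r b \<omega>. \<forall>n.
    x \<in> {cell_left r b (path_labels M \<omega> (word_prefix \<iota> n))..
         cell_left r b (path_labels M \<omega> (word_prefix \<iota> n)) + r ^ n}"
proof -
  define c where "c n = cell_left r b (path_labels M \<omega> (word_prefix \<iota> n))" for n
  \<comment> \<open>The cell of level \<open>m + k\<close> is contained in the cell of level \<open>m\<close>.\<close>
  have nested: "c m \<le> c (m + k) \<and> c (m + k) + r ^ (m + k) \<le> c m + r ^ m" for m k
  proof -
    let ?x = "path_labels M \<omega> (word_prefix \<iota> m)"
    let ?y = "drop m (path_labels M \<omega> (word_prefix \<iota> (m + k)))"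
    have "path_labels M \<omega> (word_prefix \<iota> (m + k)) \<in> words N (m + k)"
      by (rule path_labels_in_words[OF \<omega> word_prefix_in_words[OF \<iota>]])
    from drop_in_words[OF this, of m] have y: "?y \<in> words N k" by simp
    have "take m (path_labels M \<omega> (word_prefix \<iota> (m + k))) = take m ?x"
      by (rule take_path_labels) (auto simp: take_word_prefix)
    then have "path_labels M \<omega> (word_prefix \<iota> (m + k)) = take m ?x @ ?y"
      using append_take_drop_id[of m "path_labels M \<omega> (word_prefix \<iota> (m + k))"] by argo
    then have "c (m + k) = cell_left r b (take m ?x @ ?y)"
      unfolding c_def by (rule arg_cong)
    also have "\<dots> = c m + r ^ m * cell_left r b ?y"
      by (simp add: cell_left_append c_def del: append_take_drop_id)
    finally have "c (m + k) = c m + r ^ m * cell_left r b ?y" .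
    moreover have "0 \<le> r ^ m * cell_left r b ?y" "r ^ m * cell_left r b ?y \<le> r ^ m * (1 - r ^ k)"
      using cell_left_bounds[OF ifs(1,2) y] ifs(2) by (auto intro!: mult_left_mono)
    moreover have "r ^ m * (1 - r ^ k) = r ^ m - r ^ (m + k)"
      by (simp add: power_add right_diff_distrib)
    ultimately show ?thesis by linarith
  qed
  have "incseq c" by (intro incseq_SucI) (use nested[of _ 1] in auto)
  moreover have "decseq (\<lambda>n. c n + r ^ n)" by (intro decseq_SucI) (use nested[of _ 1] in auto)
  moreover have lim0: "(\<lambda>n. r ^ n) \<longlonglongrightarrow> 0" using ifs by (intro LIMSEQ_realpow_zero) auto
  ultimately obtain x where x: "\<forall>n. c n \<le> x" "\<forall>n. x \<le> c n + r ^ n"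
    using nested_sequence_unique[of c "\<lambda>n. c n + r ^ n"] tendsto_minus[OF lim0] ifs(2)
    by (force simp: incseq_Suc_iff decseq_Suc_iff)
  have "y = x" if y: "\<forall>n\<ge>1. c n \<le> y \<and> y \<le> c n + r ^ n" for y
  proof -
    have "\<forall>n\<ge>1. \<bar>y - x\<bar> \<le> r ^ n"
    proof (intro allI impI)
      fix n :: nat assume "1 \<le> n"
      then have "c n \<le> y" "y \<le> c n + r ^ n" using y by auto
      moreover have "c n \<le> x" "x \<le> c n + r ^ n" using x by auto
      ultimately show "\<bar>y - x\<bar> \<le> r ^ n" by linarith
    qed
    then have "\<bar>y - x\<bar> \<le> 0"
      by (intro LIMSEQ_le_const[OF lim0]) auto
    then show ?thesis by simp
  qed
  then have "{x} = (\<Inter>n\<in>{1..}. {c n..c n + r ^ n})"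
    using x by auto
  also have "\<dots> = (\<Inter>n\<in>{1..}. branch_map M r b \<omega> \<iota> n ` {0..1})"
    by (simp add: branch_map_image[OF ifs(2)] c_def Let_def)
  finally have "{x} = (\<Inter>n\<in>{1..}. branch_map M r b \<omega> \<iota> n ` {0..1})" .
  then have "x \<in> random_fractal M r b \<omega>" using \<iota> by (auto simp: random_fractal_def)
  then show ?thesis using x by (auto simp: c_def)
qed

section \<open>The number of occurring label words\<close>

lemma AE_suminf_finite:
  fixes f :: "nat \<Rightarrow> 'a \<Rightarrow> ennreal"
  assumes [measurable]: "\<And>n. f n \<in> borel_measurable L"
    and "(\<Sum>n. \<integral>\<^sup>+x. f n x \<partial>L) \<noteq> \<infinity>"
  shows "AE x in L. (\<Sum>n. f n x) \<noteq> \<infinity>"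
proof (rule nn_integral_PInf_AE)
  show "(\<integral>\<^sup>+x. (\<Sum>n. f n x) \<partial>L) \<noteq> \<infinity>"
    using assms(2) by (subst nn_integral_suminf) auto
qed measurable

definition level_codes :: "nat \<Rightarrow> (nat \<Rightarrow> nat) \<Rightarrow> nat \<Rightarrow> nat list set" where
  "level_codes M \<omega> n = path_labels M \<omega> ` words M n"

lemma level_codes_subset: "\<omega> \<in> space (label_space N p) \<Longrightarrow> level_codes M \<omega> n \<subseteq> words N n"
  using path_labels_in_words by (auto simp: level_codes_def)

lemma sets_mem_level_codes [measurable]:
  "{\<omega> \<in> space (label_space N p). x \<in> level_codes M \<omega> n} \<in> sets (label_space N p)"
proof -
  have "{\<omega> \<in> space (label_space N p). x \<in> level_codes M \<omega> n}
      = {\<omega> \<in> space (label_space N p). \<exists>u\<in>words M n. path_labels M \<omega> u = x}"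
    by (auto simp: level_codes_def)
  also have "\<dots> \<in> sets (label_space N p)" by measurable
  finally show ?thesis .
qed

text \<open>Union bound over the \<open>M ^ n\<close> nodes of the level, each of which carries \<open>x\<close> with probability
  \<open>prod_list (map p x)\<close>.\<close>

lemma emeasure_mem_level_codes_le:
  assumes p: "prob_vector N p" and x: "x \<in> words N n"
  shows "emeasure (label_space N p) {\<omega> \<in> space (label_space N p). x \<in> level_codes M \<omega> n}
    \<le> ennreal (min 1 (\<Prod>i\<leftarrow>x. real M * p i))"
proof -
  interpret prob_space "label_space N p" by (rule prob_space_label_space[OF p])
  let ?S = "space (label_space N p)"
  have "{\<omega> \<in> ?S. x \<in> level_codes M \<omega> n} = (\<Union>u\<in>words M n. {\<omega> \<in> ?S. path_labels M \<omega> u = x})"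
    by (auto simp: level_codes_def)
  also have "emeasure (label_space N p) \<dots>
      \<le> (\<Sum>u\<in>words M n. emeasure (label_space N p) {\<omega> \<in> ?S. path_labels M \<omega> u = x})"
    by (rule emeasure_subadditive_finite) auto
  also have "\<dots> = (\<Sum>u\<in>words M n. ennreal (prod_list (map p x)))"
  proof (rule sum.cong[OF refl])
    fix u assume u: "u \<in> words M n"
    have "x \<in> words N (length (path_indices M u))" using u x by (simp add: words_def)
    from emeasure_label_list[OF p distinct_path_indices[OF u] set_path_indices this]
    show "emeasure (label_space N p) {\<omega> \<in> ?S. path_labels M \<omega> u = x} = ennreal (prod_list (map p x))"
      by (simp add: path_labels_def)
  qed
  also have "\<dots> = ennreal (real M ^ n * prod_list (map p x))"
    by (simp add: ennreal_mult' ennreal_of_nat_eq_real_of_nat)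
  also have "real M ^ n * prod_list (map p x) = (\<Prod>i\<leftarrow>x. real M * p i)"
  proof -
    have "real M ^ length x * prod_list (map p x) = (\<Prod>i\<leftarrow>x. real M * p i)"
      by (induction x) (auto simp: algebra_simps)
    then show ?thesis using x by (simp add: words_def)
  qed
  finally have "emeasure (label_space N p) {\<omega> \<in> ?S. x \<in> level_codes M \<omega> n}
    \<le> ennreal (\<Prod>i\<leftarrow>x. real M * p i)" .
  moreover have "emeasure (label_space N p) {\<omega> \<in> ?S. x \<in> level_codes M \<omega> n} \<le> ennreal 1"
    using emeasure_le_1 by simp
  ultimately show ?thesis by (auto simp: min_def)
qed

text \<open>This interpolation between the bounds \<open>1\<close> (at \<open>l = 0\<close>) and \<open>t\<close> (at \<open>l = 1\<close>) is what
  introduces the exponent \<open>l\<close> into the upper bound.\<close>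

lemma min_one_le_powr:
  fixes t :: real
  assumes "0 < t" "0 \<le> l" "l \<le> 1"
  shows "min 1 t \<le> t powr l"
proof (cases "t \<le> 1")
  case True
  then have "t powr 1 \<le> t powr l" using assms by (intro powr_mono') auto
  then show ?thesis using assms True by simp
next
  case False
  then show ?thesis using assms by (simp add: ge_one_powr_ge_zero)
qed

lemma card_level_codes_eq_sum:
  assumes "\<omega> \<in> space (label_space N p)"
  shows "ennreal (card (level_codes M \<omega> n))
    = (\<Sum>x\<in>words N n. indicator {\<omega> \<in> space (label_space N p). x \<in> level_codes M \<omega> n} \<omega>)"
proof -
  have "(\<Sum>x\<in>words N n. indicator {\<omega> \<in> space (label_space N p). x \<in> level_codes M \<omega> n} \<omega>)
      = (\<Sum>x\<in>level_codes M \<omega> n. 1 :: ennreal)"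
    using assms level_codes_subset[OF assms, of M n] by (intro sum.mono_neutral_cong_right) auto
  then show ?thesis by (simp add: ennreal_of_nat_eq_real_of_nat)
qed

lemma expected_card_level_codes_le:
  assumes p: "prob_vector N p" and pos: "0 < M" "\<And>i. i \<in> {1..N} \<Longrightarrow> 0 < p i"
    and l: "0 \<le> l" "l \<le> 1"
  shows "(\<integral>\<^sup>+\<omega>. ennreal (card (level_codes M \<omega> n)) \<partial>label_space N p)
    \<le> ennreal ((\<Sum>i=1..N. (real M * p i) powr l) ^ n)"
proof -
  let ?L = "label_space N p"
  let ?E = "\<lambda>x. {\<omega> \<in> space ?L. x \<in> level_codes M \<omega> n}"
  have "(\<integral>\<^sup>+\<omega>. ennreal (card (level_codes M \<omega> n)) \<partial>?L)
      = (\<integral>\<^sup>+\<omega>. (\<Sum>x\<in>words N n. indicator (?E x) \<omega>) \<partial>?L)"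
    by (intro nn_integral_cong card_level_codes_eq_sum)
  also have "\<dots> = (\<Sum>x\<in>words N n. emeasure ?L (?E x))"
    by (subst nn_integral_sum) (auto intro!: sum.cong nn_integral_indicator)
  also have "\<dots> \<le> (\<Sum>x\<in>words N n. ennreal (\<Prod>i\<leftarrow>x. (real M * p i) powr l))"
  proof (rule sum_mono)
    fix x assume x: "x \<in> words N n"
    then have pos_x: "0 < real M * p i" if "i \<in> set x" for i
      using pos that by (auto simp: words_eq)
    have "min 1 (\<Prod>i\<leftarrow>x. real M * p i) \<le> (\<Prod>i\<leftarrow>x. real M * p i) powr l"
      by (intro min_one_le_powr prod_list_pos_real pos_x l)
    also have "\<dots> = (\<Prod>i\<leftarrow>x. (real M * p i) powr l)"
      by (intro prod_list_powr less_imp_le pos_x)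
    finally show "emeasure ?L (?E x) \<le> ennreal (\<Prod>i\<leftarrow>x. (real M * p i) powr l)"
      using emeasure_mem_level_codes_le[OF p x, of M] by (meson ennreal_leI order_trans)
  qed
  also have "\<dots> = ennreal (\<Sum>x\<in>words N n. (\<Prod>i\<leftarrow>x. (real M * p i) powr l))"
    by (intro sum_ennreal prod_list_powr(2)) auto
  finally show ?thesis by (simp add: sum_prod_list_words)
qed

text \<open>The expected number of occurring words grows at most like the \<open>n\<close>-th power of the sum on the left-hand side of
  the last assumption. Weighted with \<open>1 / B ^ n\<close>, the expectations form a convergent geometric series, so almost surely the
  weighted numbers have a finite sum; that sum is the constant \<open>C\<close>.\<close>

lemma AE_card_level_codes_growth:
  assumes p: "prob_vector N p" and pos: "0 < M" "\<And>i. i \<in> {1..N} \<Longrightarrow> 0 < p i"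
    and l: "0 \<le> l" "l \<le> 1" and B: "(\<Sum>i=1..N. (real M * p i) powr l) < B"
  shows "AE \<omega> in label_space N p. \<exists>C. \<forall>n. real (card (level_codes M \<omega> n)) \<le> C * B ^ n"
proof -
  let ?L = "label_space N p"
  define K where "K = (\<Sum>i=1..N. (real M * p i) powr l)"
  have K: "0 \<le> K" "K < B" using B by (auto simp: K_def sum_nonneg)
  have [measurable]: "(\<lambda>\<omega>. ennreal (card (level_codes M \<omega> n))) \<in> borel_measurable ?L" for n
    by (subst measurable_cong[OF card_level_codes_eq_sum]) measurable
  have "AE \<omega> in ?L. (\<Sum>n. ennreal (1 / B ^ n) * ennreal (card (level_codes M \<omega> n))) \<noteq> \<infinity>"
  proof (rule AE_suminf_finite)
    have "(\<Sum>n. \<integral>\<^sup>+\<omega>. ennreal (1 / B ^ n) * ennreal (card (level_codes M \<omega> n)) \<partial>?L)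
        \<le> (\<Sum>n. ennreal ((K / B) ^ n))"
    proof (rule suminf_le)
      fix n
      have "(\<integral>\<^sup>+\<omega>. ennreal (1 / B ^ n) * ennreal (card (level_codes M \<omega> n)) \<partial>?L)
          = ennreal (1 / B ^ n) * (\<integral>\<^sup>+\<omega>. ennreal (card (level_codes M \<omega> n)) \<partial>?L)"
        by (rule nn_integral_cmult) measurable
      also have "\<dots> \<le> ennreal (1 / B ^ n) * ennreal (K ^ n)"
        using expected_card_level_codes_le[OF p pos l] unfolding K_def by (intro mult_left_mono) auto
      also have "\<dots> = ennreal ((K / B) ^ n)"
        using K by (simp add: ennreal_mult'[symmetric] power_divide)
      finally show "(\<integral>\<^sup>+\<omega>. ennreal (1 / B ^ n) * ennreal (card (level_codes M \<omega> n)) \<partial>?L)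
        \<le> ennreal ((K / B) ^ n)" .
    qed auto
    also have "\<dots> = ennreal (\<Sum>n. (K / B) ^ n)"
      using K by (intro suminf_ennreal2 summable_geometric) auto
    finally show "(\<Sum>n. \<integral>\<^sup>+\<omega>. ennreal (1 / B ^ n) * ennreal (card (level_codes M \<omega> n)) \<partial>?L) \<noteq> \<infinity>"
      unfolding infinity_ennreal_def by (rule neq_top_trans[OF ennreal_neq_top])
  qed measurable
  then show ?thesis
  proof eventually_elim
    case (elim \<omega>)
    then obtain C where C: "(\<Sum>n. ennreal (1 / B ^ n) * ennreal (card (level_codes M \<omega> n))) = ennreal C" "0 \<le> C"
      by (metis ennreal_cases infinity_ennreal_def)
    have "real (card (level_codes M \<omega> n)) \<le> C * B ^ n" for n
    proof -
      have "(\<Sum>n\<in>{n}. ennreal (1 / B ^ n) * ennreal (card (level_codes M \<omega> n))) \<le> ennreal C"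
        unfolding C(1)[symmetric] by (intro sum_le_suminf) auto
      then have "ennreal (card (level_codes M \<omega> n) / B ^ n) \<le> ennreal C"
        using K by (simp add: ennreal_mult'[symmetric])
      then show ?thesis using K C(2) by (simp add: divide_le_eq)
    qed
    then show ?case by blast
  qed
qed

section \<open>The upper bound for the box dimension\<close>

lemma covering_number_le:
  assumes "finite \<U>" "E \<subseteq> \<Union>\<U>" "\<And>U. U \<in> \<U> \<Longrightarrow> bounded U \<and> diameter U \<le> \<delta>"
  shows "covering_number \<delta> E \<le> card \<U>"
  unfolding covering_number_def by (rule cInf_lower) (use assms in auto)

text \<open>Covers at the scales \<open>r ^ n\<close> suffice: a scale \<open>\<delta>\<close> is compared with the largest power
  \<open>r ^ n \<le> \<delta>\<close>. The constant \<open>C\<close> and the rounding of \<open>n\<close> contribute a bounded term, which disappears after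
  division by \<open>- ln \<delta>\<close>.\<close>

lemma upper_box_dim_le:
  fixes E :: "'a::metric_space set"
  assumes r: "0 < r" "r < 1" and B: "1 \<le> B"
    and fin: "\<And>n. 1 \<le> n \<Longrightarrow> \<exists>\<U>. finite \<U> \<and> real (card \<U>) \<le> C * B ^ n \<and> E \<subseteq> \<Union>\<U> \<and>
           (\<forall>U\<in>\<U>. bounded U \<and> diameter U \<le> r ^ n)"
  shows "upper_box_dim E \<le> ereal (ln B / - ln r)"
proof -
  define C' where "C' = max 1 C"
  have lnr: "ln r < 0" using r by simp
  have ratio: "ln (real (covering_number \<delta> E)) / - ln \<delta> \<le> (ln C' + ln B) / - ln \<delta> + ln B / - ln r"
    if \<delta>: "0 < \<delta>" "\<delta> < r" for \<delta>
  proof -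
    define n where "n = nat \<lceil>ln \<delta> / ln r\<rceil>"
    have ln\<delta>: "ln \<delta> < ln r" using \<delta> by simp
    then have "1 < ln \<delta> / ln r" using lnr by (simp add: neg_less_divide_eq)
    then have n: "1 \<le> n" "ln \<delta> / ln r \<le> real n" "real n \<le> ln \<delta> / ln r + 1"
      unfolding n_def by linarith+
    have "real n * ln r \<le> ln \<delta>" using n(2) lnr by (simp add: neg_divide_le_eq)
    then have rn: "r ^ n \<le> \<delta>"
      using r \<delta> by (subst ln_le_cancel_iff[symmetric]) (auto simp: ln_realpow)
    obtain \<U> where \<U>: "finite \<U>" "real (card \<U>) \<le> C * B ^ n" "E \<subseteq> \<Union>\<U>"
      "\<forall>U\<in>\<U>. bounded U \<and> diameter U \<le> r ^ n"
      using fin[OF n(1)] by blast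
    have "real (covering_number \<delta> E) \<le> real (card \<U>)"
      using covering_number_le[of \<U> E \<delta>] \<U> rn by fastforce
    also have "\<dots> \<le> C' * B ^ n"
      by (rule order_trans[OF \<U>(2)]) (use B in \<open>auto simp: C'_def intro!: mult_right_mono\<close>)
    finally have le: "real (covering_number \<delta> E) \<le> C' * B ^ n" .
    have "ln (real (covering_number \<delta> E)) \<le> ln (C' * B ^ n)"
    \<comment> \<open>The covering number is 0 for empty \<open>E\<close>, and then its logarithm is 0 as well.\<close>
    proof (cases "covering_number \<delta> E = 0")
      case True
      have "1 * 1 \<le> C' * B ^ n" using B by (intro mult_mono) (auto simp: C'_def)
      with True show ?thesis by simp
    next
      case False
      then show ?thesis using le by (subst ln_le_cancel_iff) linarith+
    qed
    also have "\<dots> = ln C' + real n * ln B"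
      using B by (subst ln_mult) (auto simp: C'_def ln_realpow)
    also have "\<dots> \<le> ln C' + (ln \<delta> / ln r + 1) * ln B"
      using n(3) B by (intro add_left_mono mult_right_mono) auto
    finally have "ln (real (covering_number \<delta> E)) / - ln \<delta>
        \<le> (ln C' + (ln \<delta> / ln r + 1) * ln B) / - ln \<delta>"
      using ln\<delta> lnr by (intro divide_right_mono) auto
    also have "\<dots> = (ln C' + ln B) / - ln \<delta> + ln B / - ln r"
      using ln\<delta> lnr by (simp add: field_simps)
    finally show ?thesis .
  qed
  have "((\<lambda>\<delta>. (ln C' + ln B) / - ln \<delta> + ln B / - ln r) \<longlongrightarrow> 0 + ln B / - ln r) (at_right 0)"
  proof (intro tendsto_intros tendsto_divide_0[OF tendsto_const])
    show "filterlim (\<lambda>\<delta>::real. - ln \<delta>) at_infinity (at_right 0)"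
      using ln_at_0 by (simp add: filterlim_uminus_at_top filterlim_at_top_imp_at_infinity)
  qed
  then have lim: "((\<lambda>\<delta>. ereal ((ln C' + ln B) / - ln \<delta> + ln B / - ln r)) \<longlongrightarrow> ereal (ln B / - ln r)) (at_right 0)"
    by simp
  have "upper_box_dim E \<le> Limsup (at_right 0) (\<lambda>\<delta>. ereal ((ln C' + ln B) / - ln \<delta> + ln B / - ln r))"
    unfolding upper_box_dim_def
  proof (rule Limsup_mono)
    have "eventually (\<lambda>\<delta>. \<delta> \<in> {0<..<r}) (at_right 0)"
      by (rule eventually_at_rightI[OF _ r(1)])
    then show "\<forall>\<^sub>F \<delta> in at_right 0. ereal (ln (real (covering_number \<delta> E)) / - ln \<delta>)
        \<le> ereal ((ln C' + ln B) / - ln \<delta> + ln B / - ln r)"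
      by eventually_elim (use ratio in auto)
  qed
  also have "\<dots> = ereal (ln B / - ln r)"
    by (rule lim_imp_Limsup[OF _ lim]) simp
  finally show ?thesis .
qed

lemma upper_box_dim_random_fractal_le:
  assumes r: "0 < r" "r < 1" and B: "1 \<le> B"
    and growth: "\<And>n. real (card (level_codes M \<omega> n)) \<le> C * B ^ n"
  shows "upper_box_dim (random_fractal M r b \<omega>) \<le> ereal (ln B / - ln r)"
proof (rule upper_box_dim_le[OF r B])
  fix n :: nat assume n: "1 \<le> n"
  define \<U> where "\<U> = (\<lambda>x. {cell_left r b x..cell_left r b x + r ^ n}) ` level_codes M \<omega> n"
  have "finite (level_codes M \<omega> n)" by (simp add: level_codes_def)
  then have "finite \<U>" "card \<U> \<le> card (level_codes M \<omega> n)"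
    by (auto simp: \<U>_def card_image_le)
  moreover have "random_fractal M r b \<omega> \<subseteq> \<Union>\<U>"
    using random_fractal_covered[OF r(1) _ n] by (fastforce simp: \<U>_def level_codes_def)
  moreover have "\<forall>U\<in>\<U>. bounded U \<and> diameter U \<le> r ^ n"
    using r by (auto simp: \<U>_def)
  ultimately show "\<exists>\<U>. finite \<U> \<and> real (card \<U>) \<le> C * B ^ n \<and> random_fractal M r b \<omega> \<subseteq> \<Union>\<U> \<and>
      (\<forall>U\<in>\<U>. bounded U \<and> diameter U \<le> r ^ n)"
    using growth[of n] by (intro exI[of _ \<U>]) linarith
qed

text \<open>Every growth rate \<open>B\<close> above \<open>M powr l * (\<Sum>i=1..N. p i powr l)\<close> is allowed in
  \<open>AE_card_level_codes_growth\<close>; the bound follows along a sequence of rates that decreases to this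
  value.\<close>

lemma AE_upper_box_dim_random_fractal_le:
  assumes ifs: "0 < r" "r < 1" and p: "prob_vector N p" and pos: "0 < M" "\<And>i. i \<in> {1..N} \<Longrightarrow> 0 < p i"
    and l: "0 \<le> l" "l \<le> 1"
  shows "AE \<omega> in label_space N p. upper_box_dim (random_fractal M r b \<omega>)
    \<le> ereal (- ((l * ln (real M) + ln (\<Sum>i=1..N. p i powr l)) / ln r))"
proof -
  define K where "K = (\<Sum>i=1..N. (real M * p i) powr l)"
  have K_eq: "K = real M powr l * (\<Sum>i=1..N. p i powr l)"
    unfolding K_def sum_distrib_left using pos by (intro sum.cong) (auto simp: powr_mult less_imp_le)
  have "(1::real) \<le> (\<Sum>i=1..N. p i powr l)"
  proof -
    have "p i \<le> p i powr l" if "i \<in> {1..N}" for i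
    proof -
      have "p i powr 1 \<le> p i powr l"
        using p that l pos(2)[OF that] by (intro powr_mono') (auto simp: prob_vector_def)
      then show ?thesis using pos(2)[OF that] by simp
    qed
    then have "(\<Sum>i=1..N. p i) \<le> (\<Sum>i=1..N. p i powr l)" by (rule sum_mono)
    then show ?thesis using p by (simp add: prob_vector_def)
  qed
  moreover have "1 \<le> real M powr l" using pos(1) l by (intro ge_one_powr_ge_zero) auto
  ultimately have K: "1 \<le> K" "ln K = l * ln (real M) + ln (\<Sum>i=1..N. p i powr l)"
    unfolding K_eq using mult_mono[of 1 "real M powr l" 1 "\<Sum>i=1..N. p i powr l"] pos(1)
    by (auto simp: ln_mult ln_powr)
  have "AE \<omega> in label_space N p. \<forall>k. upper_box_dim (random_fractal M r b \<omega>)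
      \<le> ereal ((ln K + 1 / real (Suc k)) / - ln r)"
  proof (subst AE_all_countable, intro allI)
    fix k
    define B where "B = K * exp (1 / real (Suc k))"
    have "K * 1 < K * exp (1 / real (Suc k))" using K(1) by (intro mult_strict_left_mono) auto
    then have "K < B" by (simp add: B_def)
    then have B: "K < B" "1 \<le> B" using K(1) by auto
    have lnB: "ln B = ln K + 1 / real (Suc k)" using K(1) by (simp add: B_def ln_mult)
    have "AE \<omega> in label_space N p. \<exists>C. \<forall>n. real (card (level_codes M \<omega> n)) \<le> C * B ^ n"
      by (rule AE_card_level_codes_growth[where l = l]) (use p pos l B(1) in \<open>simp_all add: K_def\<close>)
    then show "AE \<omega> in label_space N p. upper_box_dim (random_fractal M r b \<omega>)
        \<le> ereal ((ln K + 1 / real (Suc k)) / - ln r)"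
      by eventually_elim (use upper_box_dim_random_fractal_le[OF ifs B(2)] lnB in auto)
  qed
  then show ?thesis
  proof eventually_elim
    case (elim \<omega>)
    have "(\<lambda>k. (ln K + 1 / real (Suc k)) / - ln r) \<longlonglongrightarrow> (ln K + 0) / - ln r"
      using ifs by (intro tendsto_intros LIMSEQ_Suc[OF lim_1_over_n]) auto
    then have "(\<lambda>k. ereal ((ln K + 1 / real (Suc k)) / - ln r)) \<longlonglongrightarrow> ereal (ln K / - ln r)" by simp
    then have "upper_box_dim (random_fractal M r b \<omega>) \<le> ereal (ln K / - ln r)"
      by (rule LIMSEQ_le_const) (use elim in auto)
    then show ?case using K(2) by simp
  qed
qed

section \<open>The optimal exponent\<close>

text \<open>Intermediate value theorem: after taking logarithms, the upper bound for \<open>M\<close> says that the sum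
  is at most 0 at \<open>l = 0\<close>, and the lower bound for \<open>M\<close> says that it is at least 0 at
  \<open>l = 1\<close>.\<close>

lemma exists_optimal_exponent:
  assumes "0 < N" and p: "prob_vector N p" and pos: "0 < M" "\<And>i. i \<in> {1..N} \<Longrightarrow> 0 < p i"
    and lower: "(\<Prod>i=1..N. p i powr (- p i)) \<le> real M"
    and upper: "real M \<le> (\<Prod>i=1..N. p i) powr (- 1 / real N)"
  shows "\<exists>l\<in>{0..1::real}. (\<Sum>i=1..N. p i powr l * ln (real M * p i)) = 0"
proof -
  let ?g = "\<lambda>l::real. \<Sum>i=1..N. p i powr l * ln (real M * p i)"
  have ln_eq: "ln (real M * p i) = ln (real M) + ln (p i)" if "i \<in> {1..N}" for i
    using pos(1) pos(2)[OF that] by (simp add: ln_mult)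
  have p0: "p i \<noteq> 0" if "i \<in> {1..N}" for i using pos(2)[OF that] by simp
  have prod_p: "0 < (\<Prod>i=1..N. p i)" using pos(2) by (intro prod_pos) auto
  have "ln (real M) \<le> ln ((\<Prod>i=1..N. p i) powr (- 1 / real N))"
    using upper pos(1) prod_p p0 by (subst ln_le_cancel_iff) auto
  also have "\<dots> = - (\<Sum>i=1..N. ln (p i)) / real N"
    using prod_p p0 pos(2) by (subst ln_powr, simp, subst ln_prod) auto
  finally have "real N * ln (real M) + (\<Sum>i=1..N. ln (p i)) \<le> 0"
    using \<open>0 < N\<close> by (simp add: field_simps)
  moreover have "?g 0 = (\<Sum>i=1..N. ln (real M) + ln (p i))"
    using p0 ln_eq by (intro sum.cong) auto
  ultimately have g0: "?g 0 \<le> 0" by (simp add: sum.distrib)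
  have "0 < (\<Prod>i=1..N. p i powr (- p i))" using p0 by (intro prod_pos) auto
  then have "ln (\<Prod>i=1..N. p i powr (- p i)) \<le> ln (real M)"
    using lower pos(1) by (subst ln_le_cancel_iff) auto
  moreover have "ln (\<Prod>i=1..N. p i powr (- p i)) = (\<Sum>i=1..N. - p i * ln (p i))"
    using p0 pos(2) by (subst ln_prod) (auto simp: ln_powr)
  moreover have "?g 1 = (\<Sum>i=1..N. p i * ln (real M) + p i * ln (p i))"
    using pos(2) ln_eq by (intro sum.cong) (auto simp: distrib_left less_imp_le)
  moreover have "\<dots> = ln (real M) + (\<Sum>i=1..N. p i * ln (p i))"
    using p by (simp add: sum.distrib sum_distrib_right[symmetric] prob_vector_def)
  ultimately have g1: "0 \<le> ?g 1" by (simp add: sum_negf)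
  have "continuous_on {0..1} ?g" using p0 by (intro continuous_intros) auto
  from IVT'[OF g0 g1 _ this] show ?thesis by auto
qed

lemma powr_times_ln_strict_mono:
  fixes q :: real
  assumes "0 < q" "q \<noteq> 1" "l < l'"
  shows "q powr l * ln q < q powr l' * ln q"
proof (cases "1 < q")
  case True
  then show ?thesis using assms by (intro mult_strict_right_mono) auto
next
  case False
  then have "q powr l' < q powr l" using assms by (intro powr_less_mono') auto
  then show ?thesis using False assms by (intro mult_strict_right_mono_neg) auto
qed

text \<open>Multiplied by \<open>M powr l\<close>, the sum becomes \<open>(\<Sum>i=1..N. q i powr l * ln (q i))\<close> with \<open>q i = M * p i\<close>, the
  derivative of \<open>(\<Sum>i=1..N. q i powr l)\<close>. Each summand is nondecreasing in \<open>l\<close>, strictly unless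
  \<open>q i = 1\<close>. If all \<open>q i\<close> were \<open>1\<close>, then \<open>p\<close> would be the constant \<open>1 / M\<close>, hence uniform.\<close>

lemma optimal_exponent_unique:
  assumes p: "prob_vector N p" and pos: "0 < M" "\<And>i. i \<in> {1..N} \<Longrightarrow> 0 < p i"
    and nonuniform: "\<not> (\<forall>i\<in>{1..N}. p i = 1 / real N)"
    and roots: "(\<Sum>i=1..N. p i powr l * ln (real M * p i)) = 0"
      "(\<Sum>i=1..N. p i powr l' * ln (real M * p i)) = 0"
  shows "l = l'"
proof (rule ccontr)
  assume "l \<noteq> l'"
  then have "l < l' \<or> l' < l" by linarith
  with roots obtain l1 l2 where l: "l1 < l2" "(\<Sum>i=1..N. p i powr l1 * ln (real M * p i)) = 0"
      "(\<Sum>i=1..N. p i powr l2 * ln (real M * p i)) = 0"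
    by blast
  let ?h = "\<lambda>l::real. \<Sum>i=1..N. (real M * p i) powr l * ln (real M * p i)"
  have h: "?h l = real M powr l * (\<Sum>i=1..N. p i powr l * ln (real M * p i))" for l
    unfolding sum_distrib_left
    by (intro sum.cong) (use pos(2) in \<open>simp_all add: powr_mult less_imp_le\<close>)
  have "\<exists>j\<in>{1..N}. real M * p j \<noteq> 1"
  proof (rule ccontr)
    assume "\<not> ?thesis"
    then have pM: "p i = 1 / real M" if "i \<in> {1..N}" for i
      using that pos(1) by (auto simp: field_simps)
    then have "(\<Sum>i=1..N. p i) = real N / real M" by simp
    then have "real N = real M" using p pos(1) by (simp add: prob_vector_def)
    with pM nonuniform show False by simp
  qed
  then obtain j where j: "j \<in> {1..N}" "real M * p j \<noteq> 1" by blast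
  have "?h l1 < ?h l2"
  proof (rule sum_strict_mono_ex1)
    show "\<forall>i\<in>{1..N}. (real M * p i) powr l1 * ln (real M * p i) \<le> (real M * p i) powr l2 * ln (real M * p i)"
    proof
      fix i assume "i \<in> {1..N}"
      then show "(real M * p i) powr l1 * ln (real M * p i) \<le> (real M * p i) powr l2 * ln (real M * p i)"
        using powr_times_ln_strict_mono[of "real M * p i" l1 l2] pos l(1)
        by (cases "real M * p i = 1") (auto intro: less_imp_le)
    qed
    show "\<exists>i\<in>{1..N}. (real M * p i) powr l1 * ln (real M * p i) < (real M * p i) powr l2 * ln (real M * p i)"
      using powr_times_ln_strict_mono[of "real M * p j" l1 l2] pos j l(1) by (intro bexI[of _ j]) auto
  qed simp
  then show False using l h by simp
qed

section \<open>Hausdorff measure and discrete energy\<close>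

text \<open>The mass distribution principle for a single set \<open>U\<close>. Here \<open>nb m i\<close> is a neighbourhood of
  \<open>i\<close> at scale \<open>r ^ m\<close>, of measure at most \<open>T * (r ^ m) powr t\<close> for \<open>i\<close> in \<open>G\<close>. All points of \<open>G\<close> mapped into \<open>U\<close>
  lie in the neighbourhoods of any one of them at all scales above the diameter. The covering set \<open>C\<close> is built
  from these neighbourhoods and therefore measurable, whatever the set \<open>U\<close> is. Intersecting over all
  admissible scales also covers the case that \<open>U\<close> has diameter 0, where no scale is the smallest.\<close>

lemma frostman_covering_set:
  fixes X :: "'i \<Rightarrow> 'a::metric_space"
  assumes r: "0 < r" "r < 1" and t: "0 < t" and T: "0 \<le> T"
    and sets: "\<And>m i. i \<in> space L \<Longrightarrow> nb m i \<in> sets L"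
    and near: "\<And>m i j. i \<in> space L \<Longrightarrow> j \<in> space L \<Longrightarrow> dist (X i) (X j) \<le> r ^ m \<Longrightarrow> j \<in> nb m i"
    and G: "G \<subseteq> space L"
    and small: "\<And>m i. i \<in> G \<Longrightarrow> emeasure L (nb m i) \<le> ennreal (T * (r powr t) ^ m)"
    and U: "bounded U" "diameter U \<le> 1"
  shows "\<exists>C\<in>sets L. {i \<in> G. X i \<in> U} \<subseteq> C \<and>
    emeasure L C \<le> ennreal (T / r powr t * diameter U powr t)"
proof (cases "\<exists>i\<in>G. X i \<in> U")
  case False
  then show ?thesis by (intro bexI[of _ "{}"]) auto
next
  case True
  then obtain i where i: "i \<in> G" "X i \<in> U" by blast
  then have iL: "i \<in> space L" using G by blast
  let ?d = "diameter U" and ?R = "r powr t"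
  define J where "J = {m. ?d \<le> r ^ m}"
  define C where "C = (\<Inter>m\<in>J. nb m i)"
  have R: "0 < ?R" "?R < 1" using r t powr_less_mono2[of t r 1] by auto
  have "0 \<in> J" using U by (simp add: J_def)
  then have C_sets: "C \<in> sets L"
    unfolding C_def by (intro sets.countable_INT') (use sets iL in auto)
  have C_le: "emeasure L C \<le> ennreal (T * ?R ^ m)" if "m \<in> J" for m
  proof -
    have "emeasure L C \<le> emeasure L (nb m i)"
      using that sets[OF iL] by (intro emeasure_mono) (auto simp: C_def)
    also have "\<dots> \<le> ennreal (T * ?R ^ m)" by (rule small[OF i(1)])
    finally show ?thesis .
  qed
  have "{j \<in> G. X j \<in> U} \<subseteq> C"
  proof
    fix j assume j: "j \<in> {j \<in> G. X j \<in> U}"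
    have "dist (X i) (X j) \<le> ?d" using j i U(1) by (intro diameter_bounded_bound) auto
    then show "j \<in> C" using j G iL near by (force simp: C_def J_def)
  qed
  moreover have "emeasure L C \<le> ennreal (T / ?R * ?d powr t)"
  proof (cases "?d = 0")
    case True
    then have "m \<in> J" for m using r by (simp add: J_def)
    moreover have "(\<lambda>m. ennreal (T * ?R ^ m)) \<longlonglongrightarrow> ennreal (T * 0)"
      using R by (intro tendsto_intros LIMSEQ_realpow_zero) auto
    ultimately have "emeasure L C \<le> ennreal (T * 0)"
      by (intro LIMSEQ_le_const) (auto intro: C_le)
    then show ?thesis by simp
  next
    case False
    then have d: "0 < ?d" using diameter_ge_0[OF U(1)] by simp
    \<comment> \<open>The finest scale not below the diameter loses only one factor \<open>?R\<close>.\<close>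
    define m where "m = (LEAST m. r ^ Suc m < ?d)"
    have "\<exists>m. r ^ Suc m < ?d"
    proof -
      obtain n where "r ^ n < ?d" using real_arch_pow_inv[OF d r(2)] by blast
      moreover have "r ^ Suc n \<le> r ^ n" using r by (intro power_decreasing) auto
      ultimately show ?thesis by (intro exI[of _ n]) simp
    qed
    then have m: "r ^ Suc m < ?d" unfolding m_def by (rule LeastI_ex)
    have "?d \<le> r ^ m"
    proof (cases m)
      case 0
      then show ?thesis using U by simp
    next
      case (Suc k)
      then show ?thesis using not_less_Least[of k "\<lambda>m. r ^ Suc m < ?d"] by (simp add: m_def)
    qed
    then have "m \<in> J" by (simp add: J_def)
    have "?R ^ Suc m = (r ^ Suc m) powr t"
      using r by (simp add: powr_realpow[symmetric] powr_powr mult.commute del: power_Suc)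
    also have "\<dots> \<le> ?d powr t"
      using m r t by (intro powr_mono2) auto
    finally have "?R ^ m \<le> ?d powr t / ?R" using R by (simp add: field_simps)
    then have "T * ?R ^ m \<le> T / ?R * ?d powr t"
      using mult_left_mono[OF _ T] by fastforce
    then show ?thesis using C_le[OF \<open>m \<in> J\<close>] by (meson ennreal_leI order_trans)
  qed
  ultimately show ?thesis using C_sets by blast
qed

text \<open>If the integral of \<open>\<phi>\<close>, the potential summed over scales, is finite, then
  \<open>\<phi>\<close> is bounded by some \<open>k\<close> on a set \<open>G\<close> of positive measure. On \<open>G\<close> the
  neighbourhoods \<open>nb m i\<close> have measure at most \<open>k * (r powr t) ^ m\<close>, and \<open>frostman_covering_set\<close>, summed over the members
  of a cover of \<open>E\<close>, bounds the measure of \<open>G\<close> by a multiple of the sum of the diameters to the power \<open>t\<close>. So these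
  sums cannot be arbitrarily small. The discrete
  potential takes the place of the kernel \<open>dist x y powr (- t)\<close> of the classical energy.\<close>

lemma hausdorff_measure_nonzero_if_finite_energy:
  fixes X :: "'i \<Rightarrow> 'a::metric_space"
  assumes L: "prob_space L" and X: "\<And>i. i \<in> space L \<Longrightarrow> X i \<in> E"
    and r: "0 < r" "r < 1" and t: "0 < t"
    and sets: "\<And>m i. i \<in> space L \<Longrightarrow> nb m i \<in> sets L"
    and near: "\<And>m i j. i \<in> space L \<Longrightarrow> j \<in> space L \<Longrightarrow> dist (X i) (X j) \<le> r ^ m \<Longrightarrow> j \<in> nb m i"
    and meas [measurable]: "\<And>m. (\<lambda>i. emeasure L (nb m i)) \<in> borel_measurable L"
    and energy: "(\<Sum>m. ennreal ((1 / r powr t) ^ m) * (\<integral>\<^sup>+i. emeasure L (nb m i) \<partial>L)) \<noteq> \<infinity>"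
  shows "hausdorff_measure t E \<noteq> 0"
proof
  assume zero: "hausdorff_measure t E = 0"
  interpret prob_space L by (rule L)
  define R where "R = r powr t"
  define \<phi> where "\<phi> i = (\<Sum>m. ennreal ((1 / R) ^ m) * emeasure L (nb m i))" for i
  have R: "0 < R" using r by (simp add: R_def)
  have [measurable]: "\<phi> \<in> borel_measurable L" unfolding \<phi>_def by measurable
  have "AE i in L. \<phi> i \<noteq> \<infinity>"
    unfolding \<phi>_def using energy by (intro AE_suminf_finite) (auto simp: nn_integral_cmult R_def)
  have "\<exists>k::nat. emeasure L {i \<in> space L. \<phi> i \<le> of_nat k} \<noteq> 0"
  proof (rule ccontr)
    assume "\<not> ?thesis"
    then have "AE i in L. \<not> \<phi> i \<le> of_nat k" for k :: nat
      by (intro AE_I[where N = "{i \<in> space L. \<phi> i \<le> of_nat k}"]) auto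
    then have "AE i in L. \<forall>k::nat. \<not> \<phi> i \<le> of_nat k" by (simp add: AE_all_countable)
    with \<open>AE i in L. \<phi> i \<noteq> \<infinity>\<close> have "AE i in L. False"
    proof eventually_elim
      case (elim i)
      then have "\<phi> i < \<infinity>" by (simp add: less_top)
      then obtain k :: nat where "\<phi> i < of_nat k" using ennreal_Ex_less_of_nat by auto
      with elim show False by (meson less_imp_le)
    qed
    then show False by simp
  qed
  then obtain k :: nat where k: "emeasure L {i \<in> space L. \<phi> i \<le> of_nat k} \<noteq> 0" by blast
  define G where "G = {i \<in> space L. \<phi> i \<le> of_nat k}"
  define T where "T = real k"
  have G_small: "emeasure L (nb m i) \<le> ennreal (T * R ^ m)" if "i \<in> G" for m i
  proof -
    have "(\<Sum>m\<in>{m}. ennreal ((1 / R) ^ m) * emeasure L (nb m i)) \<le> \<phi> i"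
      unfolding \<phi>_def by (intro sum_le_suminf) auto
    also have "\<dots> \<le> ennreal T" using that by (simp add: G_def T_def ennreal_of_nat_eq_real_of_nat)
    finally have "ennreal (R ^ m) * (ennreal ((1 / R) ^ m) * emeasure L (nb m i)) \<le> ennreal (R ^ m) * ennreal T"
      by (intro mult_left_mono) auto
    moreover have "ennreal (R ^ m) * (ennreal ((1 / R) ^ m) * emeasure L (nb m i)) = emeasure L (nb m i)"
      using R by (simp add: mult.assoc[symmetric] ennreal_mult'[symmetric] power_divide)
    moreover have "ennreal (R ^ m) * ennreal T = ennreal (T * R ^ m)"
      using R by (simp add: ennreal_mult'[symmetric] T_def mult.commute)
    ultimately show ?thesis by argo
  qed
  have lower: "emeasure L G \<le> ennreal (T / R) * (\<Sum>n. ennreal (diameter (U n) powr t))"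
    if U: "E \<subseteq> (\<Union>n. U n)" "\<And>n. bounded (U n) \<and> diameter (U n) \<le> 1" for U :: "nat \<Rightarrow> 'a set"
  proof -
    have "\<exists>C\<in>sets L. {i \<in> G. X i \<in> U n} \<subseteq> C \<and> emeasure L C \<le> ennreal (T / R * diameter (U n) powr t)" for n
      unfolding R_def
      by (rule frostman_covering_set[where nb = nb])
         (use r t sets near G_small U(2) in \<open>auto simp: T_def G_def R_def\<close>)
    then obtain C where C: "\<And>n. C n \<in> sets L" "\<And>n. {i \<in> G. X i \<in> U n} \<subseteq> C n"
      "\<And>n. emeasure L (C n) \<le> ennreal (T / R * diameter (U n) powr t)"
      by metis
    have "G \<subseteq> (\<Union>n. C n)"
    proof
      fix i assume i: "i \<in> G"
      then have "X i \<in> E" using X by (simp add: G_def)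
      then obtain n where "X i \<in> U n" using U(1) by blast
      then show "i \<in> (\<Union>n. C n)" using C(2)[of n] i by blast
    qed
    then have "emeasure L G \<le> emeasure L (\<Union>n. C n)"
      using C(1) by (intro emeasure_mono sets.countable_UN) auto
    also have "\<dots> \<le> (\<Sum>n. emeasure L (C n))"
      using C(1) by (intro emeasure_subadditive_countably) auto
    also have "\<dots> \<le> (\<Sum>n. ennreal (T / R) * ennreal (diameter (U n) powr t))"
      using C(3) R by (intro suminf_le) (auto simp: ennreal_mult'[symmetric] T_def)
    finally show ?thesis by simp
  qed
  obtain g where g: "emeasure L G = ennreal g" "0 < g"
    using k unfolding G_def[symmetric] emeasure_eq_measure by (auto simp: zero_less_measure_iff)
  have "hausdorff_premeasure t 1 E \<le> hausdorff_measure t E"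
    unfolding hausdorff_measure_def by (intro SUP_upper) simp
  with zero have "hausdorff_premeasure t 1 E = 0" by simp
  \<comment> \<open>A cover this cheap violates the lower bound; the summand 1 avoids division by 0 when \<open>T = 0\<close>.\<close>
  also have "0 < ennreal (g / (T / R + 1))" using g R by (simp add: T_def add_nonneg_pos)
  finally obtain U :: "nat \<Rightarrow> 'a set" where U: "E \<subseteq> (\<Union>n. U n)" "\<And>n. bounded (U n) \<and> diameter (U n) \<le> 1"
    "(\<Sum>n. ennreal (diameter (U n) powr t)) < ennreal (g / (T / R + 1))"
    unfolding hausdorff_premeasure_def Inf_less_iff by auto
  have "ennreal g \<le> ennreal (T / R) * (\<Sum>n. ennreal (diameter (U n) powr t))"
    using lower[OF U(1,2)] g by simp
  also have "\<dots> \<le> ennreal (T / R) * ennreal (g / (T / R + 1))"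
    using U(3) by (intro mult_left_mono) auto
  also have "\<dots> = ennreal (T / R * (g / (T / R + 1)))"
    using R by (simp add: ennreal_mult'[symmetric] T_def)
  also have "\<dots> < ennreal g"
  proof -
    have "a * (g / (a + 1)) < g" if "0 \<le> a" for a
      using that g(2) by (simp add: pos_divide_less_eq algebra_simps)
    from this[of "T / R"] have "T / R * (g / (T / R + 1)) < g" using R by (simp add: T_def)
    then show ?thesis using g(2) by (intro ennreal_lessI) auto
  qed
  finally show False by simp
qed

section \<open>The energy of the uniform measure on branches\<close>

definition close_pairs ::
  "nat \<Rightarrow> real \<Rightarrow> (nat \<Rightarrow> real) \<Rightarrow> (nat \<Rightarrow> nat) \<Rightarrow> nat \<Rightarrow> (nat list \<times> nat list) set" where
  "close_pairs M r b \<omega> m = {(u, v) \<in> words M m \<times> words M m.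
     \<bar>cell_left r b (path_labels M \<omega> u) - cell_left r b (path_labels M \<omega> v)\<bar> \<le> 2 * r ^ m}"

text \<open>Up to constant factors, the Riesz \<open>t\<close>-energy of the measure on the random set induced by a uniformly random
  branch: two independent uniform branches form a close pair at level \<open>m\<close> with probability
  \<open>card (close_pairs M r b \<omega> m) / M ^ (2 * m)\<close>.\<close>

definition discrete_energy ::
  "nat \<Rightarrow> real \<Rightarrow> (nat \<Rightarrow> real) \<Rightarrow> (nat \<Rightarrow> nat) \<Rightarrow> real \<Rightarrow> ennreal" where
  "discrete_energy M r b \<omega> t =
     (\<Sum>m. ennreal ((1 / r powr t) ^ m * (1 / real M) ^ (2 * m)) * of_nat (card (close_pairs M r b \<omega> m)))"

lemma discrete_energy_mono:
  assumes "0 < r" "r < 1" "t \<le> s"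
  shows "discrete_energy M r b \<omega> t \<le> discrete_energy M r b \<omega> s"
proof -
  have "r powr s \<le> r powr t" using assms by (intro powr_mono') auto
  then have "1 / r powr t \<le> 1 / r powr s" using assms by (intro divide_left_mono) auto
  then show ?thesis
    unfolding discrete_energy_def
    by (intro suminf_le mult_right_mono ennreal_leI power_mono) auto
qed

lemma of_nat_card_pairs:
  assumes "finite A" "finite B"
  shows "of_nat (card {(u, v) \<in> A \<times> B. P u v}) = (\<Sum>u\<in>A. \<Sum>v\<in>B. if P u v then 1 else 0 :: ennreal)"
proof -
  have "(\<Sum>u\<in>A. \<Sum>v\<in>B. if P u v then 1 else 0 :: ennreal)
      = (\<Sum>z\<in>A \<times> B. if P (fst z) (snd z) then 1 else 0)"
    by (simp add: sum.cartesian_product case_prod_unfold)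
  also have "\<dots> = (\<Sum>z\<in>{(u, v) \<in> A \<times> B. P u v}. 1)"
    using assms by (intro sum.mono_neutral_cong_right) auto
  finally show ?thesis by simp
qed

text \<open>The space of branches with independent, uniformly distributed letters. It has the same form as the space of
  labels, so the facts about labels apply to it.\<close>

abbreviation uniform_word_space :: "nat \<Rightarrow> (nat \<Rightarrow> nat) measure" where
  "uniform_word_space M \<equiv> label_space M (\<lambda>_. 1 / real M)"

lemma prob_vector_uniform: "0 < M \<Longrightarrow> prob_vector M (\<lambda>_. 1 / real M)"
  by (auto simp: prob_vector_def)

lemma uniform_word_space_letters:
  "\<iota> \<in> space (uniform_word_space M) \<Longrightarrow> \<forall>k\<ge>1. \<iota> k \<in> {1..M}"
  using label_in_range by blast

lemma measurable_word_prefix [measurable]: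
  "(\<lambda>\<iota>. word_prefix \<iota> m) \<in> label_space N p \<rightarrow>\<^sub>M count_space UNIV"
  unfolding word_prefix_def by (rule measurable_label_list) (auto simp del: upt_Suc)

lemma nn_integral_word_prefix:
  assumes "0 < M"
  shows "(\<integral>\<^sup>+\<iota>. h (word_prefix \<iota> m) \<partial>uniform_word_space M)
    = ennreal ((1 / real M) ^ m) * (\<Sum>u\<in>words M m. h u)"
proof -
  let ?L = "uniform_word_space M"
  let ?Z = "\<lambda>u. {\<iota> \<in> space ?L. word_prefix \<iota> m = u}"
  have [measurable]: "?Z u \<in> sets ?L" for u by measurable
  have cyl: "emeasure ?L (?Z u) = ennreal ((1 / real M) ^ m)" if "u \<in> words M m" for u
  proof -
    have "emeasure ?L {\<iota> \<in> space ?L. map \<iota> [1..<Suc m] = u} = ennreal (prod_list (map (\<lambda>_. 1 / real M) u))"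
      by (rule emeasure_label_list[OF prob_vector_uniform[OF assms]]) (use that in \<open>auto simp del: upt_Suc\<close>)
    also have "prod_list (map (\<lambda>_. 1 / real M) u) = (1 / real M) ^ m"
      using that by (simp add: words_def map_replicate_const)
    finally show ?thesis by (simp add: word_prefix_def del: upt_Suc)
  qed
  have "(\<integral>\<^sup>+\<iota>. h (word_prefix \<iota> m) \<partial>?L)
      = (\<integral>\<^sup>+\<iota>. (\<Sum>u\<in>words M m. h u * indicator (?Z u) \<iota>) \<partial>?L)"
  proof (rule nn_integral_cong)
    fix \<iota> assume \<iota>: "\<iota> \<in> space ?L"
    have "word_prefix \<iota> m \<in> words M m"
      by (rule word_prefix_in_words[OF uniform_word_space_letters[OF \<iota>]])
    moreover have "(\<Sum>u\<in>words M m. h u * indicator (?Z u) \<iota>)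
        = (\<Sum>u\<in>words M m. if u = word_prefix \<iota> m then h u else 0)"
      using \<iota> by (intro sum.cong) (auto simp: indicator_def)
    ultimately show "h (word_prefix \<iota> m) = (\<Sum>u\<in>words M m. h u * indicator (?Z u) \<iota>)" by simp
  qed
  also have "\<dots> = (\<Sum>u\<in>words M m. h u * emeasure ?L (?Z u))"
    by (subst nn_integral_sum) (auto intro!: sum.cong nn_integral_cmult_indicator)
  also have "\<dots> = (\<Sum>u\<in>words M m. h u * ennreal ((1 / real M) ^ m))"
    using cyl by (intro sum.cong) auto
  finally show ?thesis by (simp add: sum_distrib_right[symmetric] mult.commute)
qed

text \<open>The energy criterion on the space of branches, for the coding map that sends a branch to its point in the
  random set. The neighbourhood of \<open>\<iota>\<close> at scale \<open>r ^ m\<close> consists of the branches whose cell of level \<open>m\<close> is close to that of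
  \<open>\<iota>\<close>. It depends on finitely many letters only, so that all measures in the criterion are finite
  counts.\<close>

lemma hausdorff_measure_random_fractal_nonzero:
  assumes ifs: "unit_interval_ifs N r b" "0 < r" "r < 1"
    and \<omega>: "\<omega> \<in> space (label_space N p)" and M: "0 < M" and t: "0 < t"
    and energy: "discrete_energy M r b \<omega> t \<noteq> \<infinity>"
  shows "hausdorff_measure t (random_fractal M r b \<omega>) \<noteq> 0"
proof -
  let ?L = "uniform_word_space M"
  define c where "c u = cell_left r b (path_labels M \<omega> u)" for u
  define nb where "nb m \<iota> = {\<kappa> \<in> space ?L. \<bar>c (word_prefix \<iota> m) - c (word_prefix \<kappa> m)\<bar> \<le> 2 * r ^ m}" for m \<iota>
  have "\<exists>x\<in>random_fractal M r b \<omega>. \<forall>n. c (word_prefix \<iota> n) \<le> x \<and> x \<le> c (word_prefix \<iota> n) + r ^ n"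
    if "\<iota> \<in> space ?L" for \<iota>
    using random_fractal_point[OF ifs \<omega> uniform_word_space_letters[OF that]] by (auto simp: c_def)
  then obtain X where X: "\<And>\<iota>. \<iota> \<in> space ?L \<Longrightarrow> X \<iota> \<in> random_fractal M r b \<omega>"
    "\<And>\<iota> n. \<iota> \<in> space ?L \<Longrightarrow> c (word_prefix \<iota> n) \<le> X \<iota> \<and> X \<iota> \<le> c (word_prefix \<iota> n) + r ^ n"
    by metis
  have [measurable]: "nb m \<iota> \<in> sets ?L" for m \<iota>
    unfolding nb_def by measurable
  have nb_measure: "emeasure ?L (nb m \<iota>)
      = ennreal ((1 / real M) ^ m) * (\<Sum>v\<in>words M m. if \<bar>c (word_prefix \<iota> m) - c v\<bar> \<le> 2 * r ^ m then 1 else 0)"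
    for m \<iota>
  proof -
    have "emeasure ?L (nb m \<iota>) = (\<integral>\<^sup>+\<kappa>. indicator (nb m \<iota>) \<kappa> \<partial>?L)" by simp
    also have "\<dots> = (\<integral>\<^sup>+\<kappa>. (if \<bar>c (word_prefix \<iota> m) - c (word_prefix \<kappa> m)\<bar> \<le> 2 * r ^ m then 1 else 0) \<partial>?L)"
      by (intro nn_integral_cong) (auto simp: nb_def indicator_def)
    also have "\<dots> = ennreal ((1 / real M) ^ m)
        * (\<Sum>v\<in>words M m. if \<bar>c (word_prefix \<iota> m) - c v\<bar> \<le> 2 * r ^ m then 1 else 0)"
      by (rule nn_integral_word_prefix[OF M])
    finally show ?thesis .
  qed
  have nb_integral: "(\<integral>\<^sup>+\<iota>. emeasure ?L (nb m \<iota>) \<partial>?L)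
      = ennreal ((1 / real M) ^ (2 * m)) * of_nat (card (close_pairs M r b \<omega> m))" for m
  proof -
    have "(\<integral>\<^sup>+\<iota>. emeasure ?L (nb m \<iota>) \<partial>?L) = ennreal ((1 / real M) ^ m) * (\<Sum>u\<in>words M m.
        ennreal ((1 / real M) ^ m) * (\<Sum>v\<in>words M m. if \<bar>c u - c v\<bar> \<le> 2 * r ^ m then 1 else 0))"
      unfolding nb_measure by (rule nn_integral_word_prefix[OF M])
    also have "\<dots> = ennreal ((1 / real M) ^ m) * ennreal ((1 / real M) ^ m)
        * of_nat (card (close_pairs M r b \<omega> m))"
      unfolding close_pairs_def c_def[symmetric]
      by (subst of_nat_card_pairs) (auto simp: sum_distrib_left[symmetric] mult.assoc)
    finally show ?thesis by (simp add: ennreal_mult'[symmetric] power_add[symmetric] mult_2)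
  qed
  show ?thesis
  proof (rule hausdorff_measure_nonzero_if_finite_energy[where X = X and nb = nb and L = ?L])
    show "prob_space ?L" by (rule prob_space_label_space[OF prob_vector_uniform[OF M]])
    show "(\<lambda>\<iota>. emeasure ?L (nb m \<iota>)) \<in> borel_measurable ?L" for m
      unfolding nb_measure by measurable
    show "(\<Sum>m. ennreal ((1 / r powr t) ^ m) * (\<integral>\<^sup>+\<iota>. emeasure ?L (nb m \<iota>) \<partial>?L)) \<noteq> \<infinity>"
      using energy unfolding nb_integral discrete_energy_def
      by (simp add: ennreal_mult' mult.assoc)
    show "\<kappa> \<in> nb m \<iota>" if "\<iota> \<in> space ?L" "\<kappa> \<in> space ?L" "dist (X \<iota>) (X \<kappa>) \<le> r ^ m" for m \<iota> \<kappa>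
      using X(2)[OF that(1), of m] X(2)[OF that(2), of m] that by (auto simp: nb_def dist_real_def)
  qed (use ifs t X in auto)
qed

section \<open>The expected energy\<close>

text \<open>A Schur test: \<open>2 * (f x * f y) \<le> (f x)\<^sup>2 + (f y)\<^sup>2\<close>, and by the symmetry of \<open>C\<close> both squares contribute
  the same total. It reduces the probability that two independent random words are close to the
  probability that they are equal, up to the factor \<open>k\<close>.\<close>

lemma sum_close_products_le:
  fixes f :: "'a \<Rightarrow> real"
  assumes "finite A" and sym: "\<And>x y. C x y \<Longrightarrow> C y x"
    and deg: "\<And>x. x \<in> A \<Longrightarrow> card {y \<in> A. C x y} \<le> k"
  shows "(\<Sum>x\<in>A. \<Sum>y\<in>A. if C x y then f x * f y else 0) \<le> real k * (\<Sum>x\<in>A. (f x)\<^sup>2)"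
proof -
  let ?S = "\<Sum>x\<in>A. \<Sum>y\<in>A. if C x y then (f x)\<^sup>2 else 0"
  have swap: "(\<Sum>x\<in>A. \<Sum>y\<in>A. if C x y then (f y)\<^sup>2 else 0) = ?S"
    using sym by (subst sum.swap) (auto intro!: sum.cong)
  have "2 * (\<Sum>x\<in>A. \<Sum>y\<in>A. if C x y then f x * f y else 0)
      = (\<Sum>x\<in>A. \<Sum>y\<in>A. if C x y then 2 * (f x * f y) else 0)"
    unfolding sum_distrib_left by (intro sum.cong) auto
  also have "\<dots> \<le> (\<Sum>x\<in>A. \<Sum>y\<in>A. (if C x y then (f x)\<^sup>2 else 0) + (if C x y then (f y)\<^sup>2 else 0))"
  proof (intro sum_mono)
    fix x y
    have "2 * (f x * f y) \<le> (f x)\<^sup>2 + (f y)\<^sup>2"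
      using sum_squares_bound[of "f x" "f y"] by (simp add: mult.assoc)
    then show "(if C x y then 2 * (f x * f y) else 0)
      \<le> (if C x y then (f x)\<^sup>2 else 0) + (if C x y then (f y)\<^sup>2 else 0)" by simp
  qed
  also have "\<dots> = 2 * ?S" by (simp add: sum.distrib swap)
  finally have "(\<Sum>x\<in>A. \<Sum>y\<in>A. if C x y then f x * f y else 0) \<le> ?S" by simp
  also have "?S = (\<Sum>x\<in>A. real (card {y \<in> A. C x y}) * (f x)\<^sup>2)"
    using assms(1) by (intro sum.cong) (auto simp: sum.If_cases Int_def)
  also have "\<dots> \<le> (\<Sum>x\<in>A. real k * (f x)\<^sup>2)"
    using deg by (intro sum_mono mult_right_mono) auto
  finally show ?thesis by (simp add: sum_distrib_left)
qed

text \<open>The common initial labels place both cells into one cell of level \<open>n\<close>. Rescaling it by \<open>r ^ n\<close> leaves two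
  independent random words of length \<open>m - n\<close>, whose closeness probability is at most five times
  their collision probability.\<close>

lemma emeasure_close_pair_le:
  assumes ifs: "unit_interval_ifs N r b" "0 < r" and p: "prob_vector N p"
    and u: "u \<in> words M m" and v: "v \<in> words M m" and n: "n \<le> m"
    and common: "take n u = take n v" and differ: "n < m \<Longrightarrow> u ! n \<noteq> v ! n"
  shows "emeasure (label_space N p) {\<omega> \<in> space (label_space N p). (u, v) \<in> close_pairs M r b \<omega> m}
    \<le> ennreal (5 * (\<Sum>i=1..N. (p i)\<^sup>2) ^ (m - n))"
proof -
  let ?L = "label_space N p"
  let ?k = "m - n"
  let ?js = "drop n (path_indices M u) @ drop n (path_indices M v)"
  let ?close = "\<lambda>x y. \<bar>cell_left r b x - cell_left r b y\<bar> \<le> 2 * r ^ ?k"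
  let ?Z = "\<lambda>x y. {\<omega> \<in> space ?L. map \<omega> ?js = x @ y}"
  let ?W = "words N ?k"
  have len: "length u = m" "length v = m" using u v by (auto simp: words_def)
  have "set (drop n (path_indices M w)) \<subseteq> {1..}" for w
    by (rule order_trans[OF set_drop_subset set_path_indices])
  then have js: "distinct ?js" "set ?js \<subseteq> {1..}"
    using distinct_path_indices_append[OF u v differ] by auto
  have fin: "finite {(x, y) \<in> ?W \<times> ?W. ?close x y}"
    by (rule finite_subset[of _ "?W \<times> ?W"]) auto
  have Z_sets: "?Z x y \<in> sets ?L" for x y
    using measurable_label_list[OF js(2), of N p] by measurable
  have Z: "emeasure ?L (?Z x y) = ennreal (prod_list (map p x) * prod_list (map p y))"
    if "x \<in> ?W" "y \<in> ?W" for x y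
    using emeasure_label_list[OF p js, of "x @ y"] append_in_words[OF that] len by simp
  have "{\<omega> \<in> space ?L. (u, v) \<in> close_pairs M r b \<omega> m}
      \<subseteq> (\<Union>z\<in>{(x, y) \<in> ?W \<times> ?W. ?close x y}. ?Z (fst z) (snd z))"
  proof
    fix \<omega> assume "\<omega> \<in> {\<omega> \<in> space ?L. (u, v) \<in> close_pairs M r b \<omega> m}"
    then have \<omega>: "\<omega> \<in> space ?L"
      and close: "\<bar>cell_left r b (path_labels M \<omega> u) - cell_left r b (path_labels M \<omega> v)\<bar> \<le> 2 * r ^ m"
      by (auto simp: close_pairs_def)
    define x y where "x = drop n (path_labels M \<omega> u)" and "y = drop n (path_labels M \<omega> v)"
    have xy: "x \<in> ?W" "y \<in> ?W"
      using drop_in_words[OF path_labels_in_words[OF \<omega> u]] drop_in_words[OF path_labels_in_words[OF \<omega> v]]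
      by (auto simp: x_def y_def)
    let ?w = "take n (path_labels M \<omega> u)"
    have w: "?w = take n (path_labels M \<omega> v)" using n len by (intro take_path_labels[OF common]) auto
    have "cell_left r b (?w @ x) - cell_left r b (?w @ y) = r ^ n * (cell_left r b x - cell_left r b y)"
      using n len by (simp add: cell_left_append right_diff_distrib del: append_take_drop_id)
    moreover have "?w @ x = path_labels M \<omega> u" "?w @ y = path_labels M \<omega> v"
      unfolding x_def y_def by (rule append_take_drop_id, unfold w, rule append_take_drop_id)
    ultimately have "\<bar>r ^ n * (cell_left r b x - cell_left r b y)\<bar> \<le> 2 * r ^ m"
      using close by metis
    also have "2 * r ^ m = r ^ n * (2 * r ^ ?k)" using n by (simp add: power_add[symmetric])
    finally have "?close x y" using ifs(2) by (simp add: abs_mult)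
    moreover have "\<omega> \<in> ?Z x y" using \<omega> by (simp add: x_def y_def path_labels_def drop_map)
    ultimately show "\<omega> \<in> (\<Union>z\<in>{(x, y) \<in> ?W \<times> ?W. ?close x y}. ?Z (fst z) (snd z))"
      using xy by (intro UN_I[of "(x, y)"]) auto
  qed
  then have "emeasure ?L {\<omega> \<in> space ?L. (u, v) \<in> close_pairs M r b \<omega> m}
      \<le> emeasure ?L (\<Union>z\<in>{(x, y) \<in> ?W \<times> ?W. ?close x y}. ?Z (fst z) (snd z))"
    using Z_sets fin by (intro emeasure_mono sets.finite_UN) auto
  also have "\<dots> \<le> (\<Sum>z\<in>{(x, y) \<in> ?W \<times> ?W. ?close x y}. emeasure ?L (?Z (fst z) (snd z)))"
    using Z_sets fin by (intro emeasure_subadditive_finite) auto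
  also have "\<dots> = (\<Sum>z\<in>{(x, y) \<in> ?W \<times> ?W. ?close x y}. ennreal (prod_list (map p (fst z)) * prod_list (map p (snd z))))"
    using Z by (intro sum.cong) auto
  also have "\<dots> = ennreal (\<Sum>z\<in>{(x, y) \<in> ?W \<times> ?W. ?close x y}. prod_list (map p (fst z)) * prod_list (map p (snd z)))"
  proof (rule sum_ennreal)
    have "0 \<le> prod_list (map p x)" if "x \<in> ?W" for x
      using p that by (intro prod_list_powr(2)) (auto simp: words_eq prob_vector_def)
    then show "0 \<le> prod_list (map p (fst z)) * prod_list (map p (snd z))"
      if "z \<in> {(x, y) \<in> ?W \<times> ?W. ?close x y}" for z
      using that by auto
  qed
  also have "(\<Sum>z\<in>{(x, y) \<in> ?W \<times> ?W. ?close x y}. prod_list (map p (fst z)) * prod_list (map p (snd z)))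
      = (\<Sum>x\<in>?W. \<Sum>y\<in>?W. if ?close x y then prod_list (map p x) * prod_list (map p y) else 0)"
    unfolding sum.cartesian_product by (intro sum.mono_neutral_cong_left) (auto split: if_splits)
  also have "\<dots> \<le> real 5 * (\<Sum>x\<in>?W. (prod_list (map p x))\<^sup>2)"
    by (rule sum_close_products_le) (auto simp: abs_minus_commute intro: card_close_cells_le[OF ifs])
  also have "(\<Sum>x\<in>?W. (prod_list (map p x))\<^sup>2) = (\<Sum>x\<in>?W. prod_list (map (\<lambda>i. (p i)\<^sup>2) x))"
  proof (rule sum.cong[OF refl])
    show "(prod_list (map p x))\<^sup>2 = prod_list (map (\<lambda>i. (p i)\<^sup>2) x)" for x
      by (induction x) (auto simp: power_mult_distrib)
  qed
  also have "\<dots> = (\<Sum>i=1..N. (p i)\<^sup>2) ^ ?k" by (rule sum_prod_list_words)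
  finally show ?thesis by (simp add: ennreal_leI)
qed

text \<open>Summing the bound of \<open>emeasure_close_pair_le\<close> over all common prefixes, not only the longest one, removes the
  dependence on the exact point of separation at the cost of extra nonnegative terms.\<close>

lemma emeasure_close_pair_le_sum:
  assumes ifs: "unit_interval_ifs N r b" "0 < r" and p: "prob_vector N p"
    and u: "u \<in> words M m" and v: "v \<in> words M m"
  shows "emeasure (label_space N p) {\<omega> \<in> space (label_space N p). (u, v) \<in> close_pairs M r b \<omega> m}
    \<le> ennreal (\<Sum>n\<le>m. if take n u = take n v then 5 * (\<Sum>i=1..N. (p i)\<^sup>2) ^ (m - n) else 0)"
proof -
  \<comment> \<open>The length of the longest common prefix; the disjunct \<open>n = m\<close> covers the case \<open>u = v\<close>.\<close>
  define n where "n = (LEAST n. n = m \<or> u ! n \<noteq> v ! n)"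
  have n: "n = m \<or> u ! n \<noteq> v ! n" unfolding n_def by (rule LeastI[of _ m]) simp
  have le: "n \<le> m" unfolding n_def by (rule Least_le) simp
  have "u ! k = v ! k" if "k < n" for k
    using not_less_Least[of k "\<lambda>n. n = m \<or> u ! n \<noteq> v ! n"] that by (auto simp: n_def)
  then have common: "take n u = take n v"
    using u v le by (intro nth_take_lemma) (auto simp: words_def)
  have "emeasure (label_space N p) {\<omega> \<in> space (label_space N p). (u, v) \<in> close_pairs M r b \<omega> m}
    \<le> ennreal (5 * (\<Sum>i=1..N. (p i)\<^sup>2) ^ (m - n))"
    using n by (intro emeasure_close_pair_le[OF ifs p u v le common]) auto
  also have "\<dots> \<le> ennreal (\<Sum>n\<le>m. if take n u = take n v then 5 * (\<Sum>i=1..N. (p i)\<^sup>2) ^ (m - n) else 0)"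
  proof (rule ennreal_leI)
    have "(\<Sum>n\<in>{n}. if take n u = take n v then 5 * (\<Sum>i=1..N. (p i)\<^sup>2) ^ (m - n) else 0)
        \<le> (\<Sum>n\<le>m. if take n u = take n v then 5 * (\<Sum>i=1..N. (p i)\<^sup>2) ^ (m - n) else 0)"
      using le sum_nonneg[of "{1..N}" "\<lambda>i. (p i)\<^sup>2"] by (intro sum_mono2) auto
    then show "5 * (\<Sum>i=1..N. (p i)\<^sup>2) ^ (m - n)
        \<le> (\<Sum>n\<le>m. if take n u = take n v then 5 * (\<Sum>i=1..N. (p i)\<^sup>2) ^ (m - n) else 0)"
      using common by simp
  qed
  finally show ?thesis .
qed

lemma sets_close_pairs [measurable]:
  "{\<omega> \<in> space (label_space N p). (u, v) \<in> close_pairs M r b \<omega> m} \<in> sets (label_space N p)"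
proof -
  have [measurable]: "(\<lambda>\<omega>. cell_left r b (path_labels M \<omega> w)) \<in> borel_measurable (label_space N p)" for w
    by (rule measurable_compose[OF measurable_path_labels]) simp
  show ?thesis unfolding close_pairs_def by simp measurable
qed

lemma card_close_pairs_eq_sum:
  assumes "\<omega> \<in> space L"
  shows "of_nat (card (close_pairs M r b \<omega> m)) = (\<Sum>u\<in>words M m. \<Sum>v\<in>words M m.
    indicator {\<omega> \<in> space L. (u, v) \<in> close_pairs M r b \<omega> m} \<omega> :: ennreal)"
  unfolding close_pairs_def of_nat_card_pairs[OF finite_words finite_words]
  by (intro sum.cong refl) (use assms in \<open>auto simp: indicator_def\<close>)

lemma measurable_card_close_pairs [measurable]:
  "(\<lambda>\<omega>. of_nat (card (close_pairs M r b \<omega> m)) :: ennreal) \<in> borel_measurable (label_space N p)"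
  by (subst measurable_cong[OF card_close_pairs_eq_sum]) measurable

text \<open>There are at most \<open>M ^ (m + (m - n))\<close> pairs of nodes of level \<open>m\<close> with a common prefix of length
  \<open>n\<close>: \<open>M ^ m\<close> choices for the first node, and \<open>M ^ (m - n)\<close> for the rest of the second.\<close>

lemma expected_card_close_pairs_le:
  assumes ifs: "unit_interval_ifs N r b" "0 < r" and p: "prob_vector N p"
  shows "(\<integral>\<^sup>+\<omega>. of_nat (card (close_pairs M r b \<omega> m)) \<partial>label_space N p)
    \<le> ennreal (5 * (\<Sum>n\<le>m. real M ^ (m + (m - n)) * (\<Sum>i=1..N. (p i)\<^sup>2) ^ (m - n)))"
proof -
  let ?L = "label_space N p"
  define q where "q = (\<Sum>i=1..N. (p i)\<^sup>2)"
  have q: "0 \<le> q" by (simp add: q_def sum_nonneg)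
  have "(\<integral>\<^sup>+\<omega>. of_nat (card (close_pairs M r b \<omega> m)) \<partial>?L)
      = (\<integral>\<^sup>+\<omega>. (\<Sum>u\<in>words M m. \<Sum>v\<in>words M m.
          indicator {\<omega> \<in> space ?L. (u, v) \<in> close_pairs M r b \<omega> m} \<omega>) \<partial>?L)"
    by (intro nn_integral_cong card_close_pairs_eq_sum)
  also have "\<dots> = (\<Sum>u\<in>words M m. \<Sum>v\<in>words M m.
      emeasure ?L {\<omega> \<in> space ?L. (u, v) \<in> close_pairs M r b \<omega> m})"
    by (simp add: nn_integral_sum)
  also have "\<dots> \<le> (\<Sum>u\<in>words M m. \<Sum>v\<in>words M m.
      ennreal (\<Sum>n\<le>m. if take n u = take n v then 5 * q ^ (m - n) else 0))"
    unfolding q_def by (intro sum_mono emeasure_close_pair_le_sum[OF ifs p])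
  also have "\<dots> = ennreal (\<Sum>u\<in>words M m. \<Sum>v\<in>words M m. \<Sum>n\<le>m.
      if take n u = take n v then 5 * q ^ (m - n) else 0)"
    using q by (simp add: sum_ennreal sum_nonneg)
  also have "(\<Sum>u\<in>words M m. \<Sum>v\<in>words M m. \<Sum>n\<le>m. if take n u = take n v then 5 * q ^ (m - n) else 0)
      = (\<Sum>u\<in>words M m. \<Sum>n\<le>m. real (card {v \<in> words M m. take n u = take n v}) * (5 * q ^ (m - n)))"
    by (intro sum.cong refl, subst sum.swap) (auto simp: sum.If_cases Int_def intro!: sum.cong)
  also have "\<dots> \<le> (\<Sum>u\<in>words M m. \<Sum>n\<le>m. real M ^ (m - n) * (5 * q ^ (m - n)))"
  proof (intro sum_mono mult_right_mono)
    fix u n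
    have "real (card {v \<in> words M m. take n u = take n v}) \<le> real (M ^ (m - n))"
      using card_common_prefix_le by (intro of_nat_mono)
    then show "real (card {v \<in> words M m. take n u = take n v}) \<le> real M ^ (m - n)" by simp
  qed (use q in auto)
  also have "\<dots> = 5 * (\<Sum>n\<le>m. real M ^ (m + (m - n)) * q ^ (m - n))"
    unfolding power_add by (simp add: sum_distrib_left mult_ac)
  finally show ?thesis unfolding q_def by (simp add: ennreal_leI)
qed

text \<open>The expected term at level \<open>m\<close> is at most the \<open>m\<close>-th coefficient of a Cauchy product of geometric series
  with the ratios \<open>\<alpha> = 1 / (r powr t * M)\<close> (common part of two branches) and
  \<open>\<beta> = (\<Sum>i=1..N. (p i)\<^sup>2) / r powr t\<close> (separated part).\<close>

lemma AE_discrete_energy_finite: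
  assumes ifs: "unit_interval_ifs N r b" "0 < r" and p: "prob_vector N p" and M: "0 < M"
    and branching: "1 < r powr t * real M" and labels: "(\<Sum>i=1..N. (p i)\<^sup>2) < r powr t"
  shows "AE \<omega> in label_space N p. discrete_energy M r b \<omega> t \<noteq> \<infinity>"
proof -
  let ?L = "label_space N p"
  define q where "q = (\<Sum>i=1..N. (p i)\<^sup>2)"
  define R where "R = r powr t"
  have q: "0 \<le> q" by (simp add: q_def sum_nonneg)
  have R: "0 < R" using ifs by (simp add: R_def)
  define \<alpha> \<beta> where "\<alpha> = 1 / (R * real M)" and "\<beta> = q / R"
  have \<alpha>\<beta>: "0 \<le> \<alpha>" "\<alpha> < 1" "0 \<le> \<beta>" "\<beta> < 1"
    using branching labels R q M by (auto simp: \<alpha>_def \<beta>_def q_def R_def)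
  have term_le: "(\<integral>\<^sup>+\<omega>. ennreal ((1 / R) ^ m * (1 / real M) ^ (2 * m)) * of_nat (card (close_pairs M r b \<omega> m)) \<partial>?L)
      \<le> ennreal (5 * (\<Sum>n\<le>m. \<alpha> ^ n * \<beta> ^ (m - n)))" for m
  proof -
    have "(\<integral>\<^sup>+\<omega>. ennreal ((1 / R) ^ m * (1 / real M) ^ (2 * m)) * of_nat (card (close_pairs M r b \<omega> m)) \<partial>?L)
        = ennreal ((1 / R) ^ m * (1 / real M) ^ (2 * m)) * (\<integral>\<^sup>+\<omega>. of_nat (card (close_pairs M r b \<omega> m)) \<partial>?L)"
      by (rule nn_integral_cmult) measurable
    also have "\<dots> \<le> ennreal ((1 / R) ^ m * (1 / real M) ^ (2 * m))
        * ennreal (5 * (\<Sum>n\<le>m. real M ^ (m + (m - n)) * q ^ (m - n)))"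
      unfolding q_def by (intro mult_left_mono expected_card_close_pairs_le[OF ifs p]) auto
    also have "\<dots> = ennreal ((1 / R) ^ m * (1 / real M) ^ (2 * m)
        * (5 * (\<Sum>n\<le>m. real M ^ (m + (m - n)) * q ^ (m - n))))"
      using R by (intro ennreal_mult'[symmetric]) auto
    also have "(1 / R) ^ m * (1 / real M) ^ (2 * m) * (5 * (\<Sum>n\<le>m. real M ^ (m + (m - n)) * q ^ (m - n)))
        = 5 * (\<Sum>n\<le>m. (1 / R) ^ m * (1 / real M) ^ (2 * m) * (real M ^ (m + (m - n)) * q ^ (m - n)))"
      by (simp add: sum_distrib_left mult_ac)
    also have "(\<Sum>n\<le>m. (1 / R) ^ m * (1 / real M) ^ (2 * m) * (real M ^ (m + (m - n)) * q ^ (m - n)))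
        = (\<Sum>n\<le>m. \<alpha> ^ n * \<beta> ^ (m - n))"
    proof (rule sum.cong[OF refl])
      fix n assume "n \<in> {..m}"
      then have exponents: "n + (m - n) = m" "n + (m + (m - n)) = 2 * m" by simp_all
      have "R ^ m = R ^ n * R ^ (m - n)" "real M ^ (2 * m) = real M ^ n * real M ^ (m + (m - n))"
        unfolding power_add[symmetric] exponents by (rule refl)+
      then show "(1 / R) ^ m * (1 / real M) ^ (2 * m) * (real M ^ (m + (m - n)) * q ^ (m - n)) = \<alpha> ^ n * \<beta> ^ (m - n)"
        using R M by (simp add: \<alpha>_def \<beta>_def power_divide power_mult_distrib)
    qed
    finally show ?thesis .
  qed
  have "summable (\<lambda>m. \<Sum>n\<le>m. \<alpha> ^ n * \<beta> ^ (m - n))"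
    using \<alpha>\<beta> by (intro summable_Cauchy_product) (auto simp: summable_geometric)
  then have summable: "summable (\<lambda>m. 5 * (\<Sum>n\<le>m. \<alpha> ^ n * \<beta> ^ (m - n)))" by (rule summable_mult)
  show ?thesis
    unfolding discrete_energy_def R_def[symmetric]
  proof (rule AE_suminf_finite)
    have "(\<Sum>m. \<integral>\<^sup>+\<omega>. ennreal ((1 / R) ^ m * (1 / real M) ^ (2 * m)) * of_nat (card (close_pairs M r b \<omega> m)) \<partial>?L)
        \<le> (\<Sum>m. ennreal (5 * (\<Sum>n\<le>m. \<alpha> ^ n * \<beta> ^ (m - n))))"
      using term_le by (rule suminf_le) auto
    also have "\<dots> = ennreal (\<Sum>m. 5 * (\<Sum>n\<le>m. \<alpha> ^ n * \<beta> ^ (m - n)))"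
      using \<alpha>\<beta> by (intro suminf_ennreal2 summable) (auto intro!: sum_nonneg)
    finally show "(\<Sum>m. \<integral>\<^sup>+\<omega>. ennreal ((1 / R) ^ m * (1 / real M) ^ (2 * m)) * of_nat (card (close_pairs M r b \<omega> m)) \<partial>?L) \<noteq> \<infinity>"
      unfolding infinity_ennreal_def by (rule neq_top_trans[OF ennreal_neq_top])
  qed measurable
qed

section \<open>The dimension bounds\<close>

text \<open>For \<open>t\<close> below the minimum both ratios in \<open>AE_discrete_energy_finite\<close> are less than 1. The exceptional null set depends
  on \<open>t\<close>; restricting to rational \<open>t\<close> makes it a single one, and monotonicity of the energy
  in the exponent covers the real values in between.\<close>

lemma AE_hausdorff_dim_random_fractal_ge:
  assumes ifs: "unit_interval_ifs N r b" "0 < r" "r < 1" and p: "prob_vector N p" and M: "0 < M"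
  shows "AE \<omega> in label_space N p. hausdorff_dim (random_fractal M r b \<omega>)
    \<ge> ereal (min (- (ln (real M) / ln r)) (ln (\<Sum>i=1..N. (p i)\<^sup>2) / ln r))"
proof -
  let ?L = "label_space N p"
  define q where "q = (\<Sum>i=1..N. (p i)\<^sup>2)"
  define s where "s = min (- (ln (real M) / ln r)) (ln q / ln r)"
  have lnr: "ln r < 0" using ifs by simp
  have q: "0 < q"
  proof -
    have "\<exists>i\<in>{1..N}. p i \<noteq> 0"
    proof (rule ccontr)
      assume "\<not> ?thesis"
      then have "(\<Sum>i=1..N. p i) = 0" by (intro sum.neutral) auto
      with p show False by (simp add: prob_vector_def)
    qed
    then obtain i where i: "i \<in> {1..N}" "p i \<noteq> 0" by blast
    then have "0 < (p i)\<^sup>2" by simp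
    then show ?thesis unfolding q_def using i(1) by (intro sum_pos2[of _ i]) auto
  qed
  have finite_energy: "AE \<omega> in ?L. discrete_energy M r b \<omega> t \<noteq> \<infinity>" if t: "t < s" for t
  proof (rule AE_discrete_energy_finite[OF ifs(1,2) p M])
    have ts: "t < - ln (real M) / ln r" "t < ln q / ln r" using t by (simp_all add: s_def)
    have "- ln (real M) < t * ln r" using ts(1) lnr by (simp only: neg_less_divide_eq)
    moreover have "ln (r powr t * real M) = t * ln r + ln (real M)"
      using ifs M by (simp add: ln_mult ln_powr)
    ultimately have "0 < ln (r powr t * real M)" by simp
    moreover have "0 < r powr t * real M" using ifs M by simp
    ultimately show "1 < r powr t * real M" by (simp only: ln_gt_zero_iff)
    have "ln q < t * ln r" using ts(2) lnr by (simp only: neg_less_divide_eq)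
    then have "ln q < ln (r powr t)" using ifs by (simp add: ln_powr)
    moreover have "0 < r powr t" using ifs by simp
    ultimately have "q < r powr t" using q by (simp only: ln_less_cancel_iff)
    then show "(\<Sum>i=1..N. (p i)\<^sup>2) < r powr t" unfolding q_def .
  qed
  have "AE \<omega> in ?L. \<forall>t\<in>\<rat> \<inter> {..<s}. discrete_energy M r b \<omega> t \<noteq> \<infinity>"
    by (subst AE_ball_countable) (intro countable_Int1 countable_rat, intro ballI finite_energy, simp)
  with AE_space show ?thesis
  proof eventually_elim
    case (elim \<omega>)
    have "s \<le> t" if t: "0 < t" "hausdorff_measure t (random_fractal M r b \<omega>) = 0" for t
    proof (rule ccontr)
      assume "\<not> s \<le> t"
      then have "t < s" by simp
      then obtain t' where t': "t' \<in> \<rat>" "t < t'" "t' < s" using Rats_dense_in_real by blast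
      have "discrete_energy M r b \<omega> t \<le> discrete_energy M r b \<omega> t'"
        using t'(2) ifs by (intro discrete_energy_mono) auto
      moreover have "discrete_energy M r b \<omega> t' \<noteq> \<infinity>" using bspec[OF elim(2), of t'] t' by simp
      ultimately have "discrete_energy M r b \<omega> t \<noteq> \<infinity>"
        unfolding infinity_ennreal_def by (rule neq_top_trans[rotated])
      from hausdorff_measure_random_fractal_nonzero[OF ifs elim(1) M t(1) this] t(2)
      show False by contradiction
    qed
    then have "ereal s \<le> hausdorff_dim (random_fractal M r b \<omega>)"
      unfolding hausdorff_dim_def by (intro Inf_greatest) auto
    then show ?case unfolding s_def q_def .
  qed
qed

theorem theorem2p2:
  fixes N M :: nat and r :: real and b p :: "nat \<Rightarrow> real"
  assumes "2 \<le> N" and "2 \<le> M"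
    and "0 < r" and "r \<le> 1 / real N"
    and "unit_interval_ifs N r b"
    and "prob_vector N p"
  shows
    "(AE \<omega> in label_space N p.
        hausdorff_dim (random_fractal M r b \<omega>)
          \<ge> ereal (min (- (ln (real M) / ln r)) (ln (\<Sum>i=1..N. (p i)\<^sup>2) / ln r)))
     \<and>
     ((\<Prod>i=1..N. p i powr (- p i)) \<le> real M
        \<and> real M \<le> (\<Prod>i=1..N. p i) powr (- 1 / real N) \<longrightarrow>
        (\<exists>l\<in>{0..1::real}. (\<Sum>i=1..N. p i powr l * ln (real M * p i)) = 0)
        \<and> (\<not> (\<forall>i\<in>{1..N}. p i = 1 / real N) \<longrightarrow>
             (\<exists>!l::real. l \<in> {0..1} \<and> (\<Sum>i=1..N. p i powr l * ln (real M * p i)) = 0))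
        \<and> (\<forall>l\<in>{0..1::real}. (\<Sum>i=1..N. p i powr l * ln (real M * p i)) = 0 \<longrightarrow>
             (AE \<omega> in label_space N p.
                upper_box_dim (random_fractal M r b \<omega>)
                  \<le> ereal (- ((l * ln (real M) + ln (\<Sum>i=1..N. p i powr l)) / ln r)))))"
proof (rule conjI, goal_cases)
  have "1 / real N \<le> 1 / 2" using assms(1) by (intro divide_left_mono) auto
  then have r: "r < 1" using assms(4) by linarith
  {
    case 1
    show ?case using assms r by (intro AE_hausdorff_dim_random_fractal_ge) auto
  next
    case 2
    show ?case
    proof (intro impI, elim conjE)
      let ?root = "\<lambda>l::real. (\<Sum>i=1..N. p i powr l * ln (real M * p i)) = 0"
      assume lower: "(\<Prod>i=1..N. p i powr (- p i)) \<le> real M"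
        and upper: "real M \<le> (\<Prod>i=1..N. p i) powr (- 1 / real N)"
      have pos: "0 < M" "0 < N" using assms by auto
      have p_pos: "0 < p i" if "i \<in> {1..N}" for i
        using prob_nonzero_if_le_geometric_mean[OF pos(1) upper] that assms(6)
        by (force simp: prob_vector_def less_le)
      have exists: "\<exists>l\<in>{0..1}. ?root l"
        using p_pos by (intro exists_optimal_exponent[OF pos(2) assms(6) pos(1) _ lower upper])
      moreover have "\<exists>!l. l \<in> {0..1} \<and> ?root l" if "\<not> (\<forall>i\<in>{1..N}. p i = 1 / real N)"
        using exists optimal_exponent_unique[OF assms(6) pos(1) p_pos that] by blast
      moreover have "AE \<omega> in label_space N p. upper_box_dim (random_fractal M r b \<omega>)
          \<le> ereal (- ((l * ln (real M) + ln (\<Sum>i=1..N. p i powr l)) / ln r))" if "l \<in> {0..1}" for l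
        using that p_pos assms r pos by (intro AE_upper_box_dim_random_fractal_le) auto
      ultimately show "(\<exists>l\<in>{0..1}. ?root l)
        \<and> (\<not> (\<forall>i\<in>{1..N}. p i = 1 / real N) \<longrightarrow> (\<exists>!l. l \<in> {0..1} \<and> ?root l))
        \<and> (\<forall>l\<in>{0..1}. ?root l \<longrightarrow> (AE \<omega> in label_space N p. upper_box_dim (random_fractal M r b \<omega>)
          \<le> ereal (- ((l * ln (real M) + ln (\<Sum>i=1..N. p i powr l)) / ln r))))"
        by blast
    qed
  }
qed

end
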